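(* Let $m,n$ be positive integers, $N=mn$, $c_{m,n}=\frac{(N-2)(n-1)}{2}$. Let $\mathcal{C}_{m,n}$ be the set of tuples $(x_1,\dots,x_N)$ of integers with $0\le x_i\le n-1$ and $\sum_i x_i\equiv c_{m,n}\pmod n$. Let $\mathrm{shift}(x_1,\dots,x_N)=(x_1+1,\dots,x_N+1)$ (addition modulo $n$), and let $\widehat{\mathcal{C}}_{m,n}$ be the set of equivalence classes of $\mathcal{C}_{m,n}$ under $x\sim\mathrm{shift}^j(x)$, $j\in\mathbb{N}$. Let $\widehat{\tau}_{m,n}$ be the permutation representation of $S_N$ on $\widehat{\mathcal{C}}_{m,n}$ induced by permuting coordinates. Let $B_{m,n}$ be the set of words $w=w_1\cdots w_{(m+1)n}\in\{0,1\}^{(m+1)n}$ with $n$ zeros and $mn$ ones, $w_1=0$, and $\sum_{i:\,w_i=1}i\equiv-1\pmod n$, and let $B^L_{m,n}$ be the set of $w\in B_{m,n}$ that are Lyndon words (strictly lexicographically smallest among all their cyclic rotations, with $0<1$). For $w\in B^L_{m,n}$ let $\mathrm{c}(w)$ be the sequence of lengths of the maximal runs of consecutive $1$s in $w$, and $\mathrm{sort}(\mathrm{c}(w))$ its nonincreasing rearrangement (a partition of $N$). Then \[ \mathrm{Frob}(\widehat{\tau}_{m,n})=\sum_{w\in B^L_{m,n}}h_{\mathrm{sort}(\mathrm{c}(w))}. \] In particular the number of $S_N$-orbits of $\widehat{\mathcal{C}}_{m,n}$ equals \[ |B^L_{m,n}|=\frac{|Y_{m,n}|}{n}=\frac{1}{n^2}\sum_{d\mid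 n}(-1)^{m(n+d)}\mu(n/d)\binom{(m+1)d-1}{md}, \] where $Y_{m,n}$ is the set of nonincreasing tuples in $\mathcal{C}_{m,n}$ and $\mu$ is the Möbius function.
   Context: $\mathrm{Frob}$ denotes the Frobenius characteristic map from $S_N$-representations to symmetric functions; $h_\mu$ is the complete homogeneous symmetric function indexed by the partition $\mu$. *)

theory Defs
  imports
    Complex_Main
    "HOL-Library.Multiset"
    "HOL-Library.FuncSet"
    "HOL-Computational_Algebra.Squarefree"
    "HOL-Number_Theory.Cong"
    "HOL-Combinatorics.Orbits"
    "HOL-Algebra.Sym_Groups"
    "HOL-Algebra.Group_Action"
begin

section \<open>Symmetric functions and the Frobenius characteristic\<close>

text \<open>
  A formal power series in the variables \<open>x\<^sub>0, x\<^sub>1, x\<^sub>2, \<dots>\<close> is given by its coefficients. The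
  monomial \<open>x\<^bsub>i\<^esub> x\<^bsub>j\<^esub> \<cdots> x\<^bsub>k\<^esub>\<close> is encoded as the multiset \<open>{#i, j, \<dots>, k#}\<close> of the indices of its
  variables, so that \<open>size\<close> is the degree and \<open>+\<close> is multiplication of monomials. Symmetric
  functions are particular such series.
\<close>

type_synonym series = "nat multiset \<Rightarrow> complex"

definition series_one :: series where
  "series_one M = (if M = {#} then 1 else 0)"

definition series_mult :: "series \<Rightarrow> series \<Rightarrow> series" where
  "series_mult f g M = (\<Sum>A | A \<subseteq># M. f A * g (M - A))"

definition series_prod :: "series list \<Rightarrow> series" where
  "series_prod fs = foldr series_mult fs series_one"

definition homogeneous_sym :: "nat \<Rightarrow> series" where
  "homogeneous_sym k M = (if size M = k then 1 else 0)"

definition power_sum_sym :: "nat \<Rightarrow> series" where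
  "power_sum_sym k M = (if \<exists>i. M = replicate_mset k i then 1 else 0)"

definition h_sym :: "nat list \<Rightarrow> series" where
  "h_sym \<mu> = series_prod (map homogeneous_sym \<mu>)"

definition p_sym :: "nat list \<Rightarrow> series" where
  "p_sym \<mu> = series_prod (map power_sum_sym \<mu>)"

definition cycle_type :: "nat \<Rightarrow> (nat \<Rightarrow> nat) \<Rightarrow> nat list" where
  "cycle_type N \<sigma> = rev (sorted_list_of_multiset
     (image_mset card (mset_set (Orbits.orbit \<sigma> ` {1..N}))))"

text \<open>
  A complex representation is a family of matrices \<open>\<rho> g\<close> whose rows and columns are indexed by a
  finite basis \<open>E\<close>.
\<close>

definition rep_character :: "'x set \<Rightarrow> ('g \<Rightarrow> 'x \<Rightarrow> 'x \<Rightarrow> complex) \<Rightarrow> 'g \<Rightarrow> complex" where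
  "rep_character E \<rho> g = (\<Sum>x\<in>E. \<rho> g x x)"

text \<open>\<open>Frob(\<rho>) = 1/N! \<Sum>\<^bsub>\<sigma>\<in>S_N\<^esub> \<chi>\<^bsub>\<rho>\<^esub>(\<sigma>) p\<^bsub>cycle type of \<sigma>\<^esub>\<close>\<close>

definition Frob ::
  "nat \<Rightarrow> 'x set \<Rightarrow> ((nat \<Rightarrow> nat) \<Rightarrow> 'x \<Rightarrow> 'x \<Rightarrow> complex) \<Rightarrow> series" where
  "Frob N E \<rho> M = (\<Sum>\<sigma>\<in>carrier (sym_group N).
     rep_character E \<rho> \<sigma> * p_sym (cycle_type N \<sigma>) M) / fact N"

text \<open>The matrix of \<open>g\<close> sends the basis vector \<open>y\<close> to the basis vector \<open>\<phi> g y\<close>.\<close>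

definition perm_rep :: "('g \<Rightarrow> 'x \<Rightarrow> 'x) \<Rightarrow> 'g \<Rightarrow> 'x \<Rightarrow> 'x \<Rightarrow> complex" where
  "perm_rep \<phi> g x y = (if x = \<phi> g y then 1 else 0)"


section \<open>Tuples modulo shifts\<close>

text \<open>
  The division is exact: if \<open>n\<close> is even then so is \<open>m n - 2\<close>. The integers matter for \<open>m = n = 1\<close>.
\<close>

definition c_const :: "nat \<Rightarrow> nat \<Rightarrow> int" where
  "c_const m n = (int (m * n) - 2) * (int n - 1) div 2"

definition tuples :: "nat \<Rightarrow> nat \<Rightarrow> (nat \<Rightarrow> int) set" where
  "tuples m n = {x \<in> {1..m*n} \<rightarrow>\<^sub>E {0..int n - 1}.
     [(\<Sum>i = 1..m*n. x i) = c_const m n] (mod int n)}"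

definition shift :: "nat \<Rightarrow> nat \<Rightarrow> (nat \<Rightarrow> int) \<Rightarrow> nat \<Rightarrow> int" where
  "shift m n x = (\<lambda>i\<in>{1..m*n}. (x i + 1) mod int n)"

definition shift_rel :: "nat \<Rightarrow> nat \<Rightarrow> ((nat \<Rightarrow> int) \<times> (nat \<Rightarrow> int)) set" where
  "shift_rel m n = {(x, y). x \<in> tuples m n \<and> (\<exists>j. y = (shift m n ^^ j) x)}"

definition tuple_classes :: "nat \<Rightarrow> nat \<Rightarrow> (nat \<Rightarrow> int) set set" where
  "tuple_classes m n = tuples m n // shift_rel m n"

text \<open>
  The left action \<open>(\<sigma> x)\<^bsub>i\<^esub> = x\<^bsub>\<sigma>\<^sup>-\<^sup>1(i)\<^esub>\<close> on tuples, applied elementwise to a class.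
\<close>

definition class_action ::
  "nat \<Rightarrow> nat \<Rightarrow> (nat \<Rightarrow> nat) \<Rightarrow> (nat \<Rightarrow> int) set \<Rightarrow> (nat \<Rightarrow> int) set" where
  "class_action m n \<sigma> = (\<lambda>K\<in>tuple_classes m n. (\<lambda>x. x \<circ> inv' \<sigma>) ` K)"

definition tau_hat ::
  "nat \<Rightarrow> nat \<Rightarrow> (nat \<Rightarrow> nat) \<Rightarrow> (nat \<Rightarrow> int) set \<Rightarrow> (nat \<Rightarrow> int) set \<Rightarrow> complex" where
  "tau_hat m n = perm_rep (class_action m n)"

definition noninc_tuples :: "nat \<Rightarrow> nat \<Rightarrow> (nat \<Rightarrow> int) set" where
  "noninc_tuples m n = {x \<in> tuples m n. antimono_on {1..m*n} x}"


section \<open>Lyndon words\<close>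

text \<open>The letter \<open>w\<^bsub>i\<^esub>\<close>, counted from \<open>1\<close>, is \<open>w ! (i - 1)\<close>.\<close>

definition B_words :: "nat \<Rightarrow> nat \<Rightarrow> nat list set" where
  "B_words m n = {w. set w \<subseteq> {0, 1} \<and> length w = (m + 1) * n \<and>
     count_list w 0 = n \<and> count_list w 1 = m * n \<and> w ! 0 = 0 \<and>
     [(\<Sum>i | i \<in> {1..length w} \<and> w ! (i - 1) = 1. int i) = -1] (mod int n)}"

definition lyndon :: "nat list \<Rightarrow> bool" where
  "lyndon w \<longleftrightarrow> w \<noteq> [] \<and>
     (\<forall>k. 0 < k \<and> k < length w \<longrightarrow> (w, rotate k w) \<in> lexord less_than)"

definition BL_words :: "nat \<Rightarrow> nat \<Rightarrow> nat list set" where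
  "BL_words m n = {w \<in> B_words m n. lyndon w}"

text \<open>The lengths of the maximal runs of consecutive ones, from left to right.\<close>

declare length_dropWhile_le [termination_simp]

fun one_runs :: "nat list \<Rightarrow> nat list" where
  "one_runs [] = []"
| "one_runs (a # w) = (if a = 1
     then Suc (length (takeWhile (\<lambda>b. b = 1) w)) # one_runs (dropWhile (\<lambda>b. b = 1) w)
     else one_runs w)"

definition sort_noninc :: "nat list \<Rightarrow> nat list" where
  "sort_noninc xs = rev (sort xs)"

definition moebius_mu :: "nat \<Rightarrow> int" where
  "moebius_mu n = (if squarefree n then (-1) ^ card (prime_factors n) else 0)"


section \<open>Well-definedness\<close>

lemma shift_tuples:
  assumes "0 < n" "x \<in> tuples m n"
  shows "shift m n x \<in> tuples m n"
proof -
  have "[(\<Sum>i = 1..m*n. shift m n x i) = (\<Sum>i = 1..m*n. x i + 1)] (mod int n)"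
    by (intro cong_sum) (auto simp: shift_def cong_def)
  also have "(\<Sum>i = 1..m*n. x i + 1) = (\<Sum>i = 1..m*n. x i) + int m * int n"
    by (simp add: sum.distrib)
  also have "[\<dots> = (\<Sum>i = 1..m*n. x i)] (mod int n)"
    by (simp add: cong_def)
  also have "[(\<Sum>i = 1..m*n. x i) = c_const m n] (mod int n)"
    using assms by (simp add: tuples_def)
  finally show ?thesis
    using assms by (auto simp: tuples_def shift_def)
qed

lemma funpow_shift_tuples:
  assumes "0 < n" "x \<in> tuples m n"
  shows "(shift m n ^^ j) x \<in> tuples m n"
  by (induction j) (use assms shift_tuples in auto)

lemma funpow_shift_eq:
  assumes "x \<in> tuples m n"
  shows "(shift m n ^^ j) x = (\<lambda>i\<in>{1..m*n}. (x i + int j) mod int n)"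
proof (induction j)
  case 0
  have "x i = (\<lambda>i\<in>{1..m*n}. x i mod int n) i" for i
    using assms by (fastforce simp: tuples_def PiE_iff extensional_def Pi_iff)
  then show ?case by auto
next
  case (Suc j)
  then show ?case
    by (auto simp: shift_def mod_simps algebra_simps cong: restrict_cong)
qed

lemma funpow_shift_period:
  assumes "x \<in> tuples m n"
  shows "(shift m n ^^ (j * n)) x = x"
  using funpow_shift_eq[OF assms, of "j * n"] funpow_shift_eq[OF assms, of 0] by simp

lemma equiv_shift_rel:
  assumes "0 < n"
  shows "equiv (tuples m n) (shift_rel m n)"
proof (rule equivI)
  show "shift_rel m n \<subseteq> tuples m n \<times> tuples m n"
    using funpow_shift_tuples[OF assms] by (auto simp: shift_rel_def)
  show "refl_on (tuples m n) (shift_rel m n)"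
    by (auto simp: refl_on_def shift_rel_def intro: exI[of _ 0])
  show "sym (shift_rel m n)"
  proof (rule symI)
    fix x y assume "(x, y) \<in> shift_rel m n"
    then obtain j where x: "x \<in> tuples m n" and y: "y = (shift m n ^^ j) x"
      by (auto simp: shift_rel_def)
    have "j * n = (j * n - j) + j"
      using assms by (cases n) auto
    then have "(shift m n ^^ (j * n - j)) y = (shift m n ^^ (j * n)) x"
      by (metis y comp_apply funpow_add)
    also have "\<dots> = x"
      by (rule funpow_shift_period[OF x])
    finally have "x = (shift m n ^^ (j * n - j)) y" by simp
    then show "(y, x) \<in> shift_rel m n"
      using funpow_shift_tuples[OF assms x] y by (auto simp: shift_rel_def)
  qed
  show "trans (shift_rel m n)"
    by (rule transI) (auto simp: shift_rel_def, metis comp_apply funpow_add)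
qed

lemma perm_tuples:
  assumes p: "p permutes {1..m*n}" and x: "x \<in> tuples m n"
  shows "x \<circ> p \<in> tuples m n"
proof -
  have "(\<Sum>i = 1..m*n. (x \<circ> p) i) = (\<Sum>i = 1..m*n. x i)"
    using sum.permute[OF p, of x] by simp
  moreover have "x \<circ> p \<in> {1..m*n} \<rightarrow>\<^sub>E {0..int n - 1}"
  proof (rule PiE_I)
    fix i assume "i \<in> {1..m*n}"
    then have "p i \<in> {1..m*n}"
      using permutes_in_image[OF p] by blast
    moreover have "x \<in> {1..m*n} \<rightarrow>\<^sub>E {0..int n - 1}"
      using x by (simp add: tuples_def)
    ultimately show "(x \<circ> p) i \<in> {0..int n - 1}"
      unfolding comp_apply by (rule PiE_mem[rotated])
  next
    fix i assume i: "i \<notin> {1..m*n}"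
    moreover have "x \<in> {1..m*n} \<rightarrow>\<^sub>E {0..int n - 1}"
      using x by (simp add: tuples_def)
    ultimately show "(x \<circ> p) i = undefined"
      using permutes_not_in[OF p i] PiE_arb by fastforce
  qed
  ultimately show ?thesis
    using x by (simp add: tuples_def)
qed

lemma perm_funpow_shift:
  assumes p: "p permutes {1..m*n}" and x: "x \<in> tuples m n"
  shows "(shift m n ^^ j) x \<circ> p = (shift m n ^^ j) (x \<circ> p)"
proof
  fix i
  show "((shift m n ^^ j) x \<circ> p) i = (shift m n ^^ j) (x \<circ> p) i"
    unfolding funpow_shift_eq[OF x] funpow_shift_eq[OF perm_tuples[OF p x]]
    using permutes_in_image[OF p, of i] by (simp add: restrict_def)
qed

lemma perm_class:
  assumes p: "p permutes {1..m*n}" and x: "x \<in> tuples m n"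
  shows "(\<lambda>y. y \<circ> p) ` (shift_rel m n `` {x}) = shift_rel m n `` {x \<circ> p}"
  using x perm_tuples[OF p x] perm_funpow_shift[OF p x]
  by (fastforce simp: shift_rel_def image_iff)

lemma perm_tuple_classes:
  assumes p: "p permutes {1..m*n}" and K: "K \<in> tuple_classes m n"
  shows "(\<lambda>y. y \<circ> p) ` K \<in> tuple_classes m n"
  using K unfolding tuple_classes_def
  by (elim quotientE) (simp only: perm_class[OF p] quotientI perm_tuples[OF p])

lemma group_action_class_action:
  "group_action (sym_group (m * n)) (tuple_classes m n) (class_action m n)"
proof -
  have mem: "class_action m n \<sigma> K \<in> tuple_classes m n"
    if "\<sigma> permutes {1..m*n}" "K \<in> tuple_classes m n" for \<sigma> K
    using that perm_tuple_classes[OF permutes_inv[OF that(1)]] by (simp add: class_action_def)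
  have comp: "class_action m n (\<sigma> \<circ> \<rho>) K = class_action m n \<sigma> (class_action m n \<rho> K)"
    if "\<sigma> permutes {1..m*n}" "\<rho> permutes {1..m*n}" "K \<in> tuple_classes m n" for \<sigma> \<rho> K
    using that mem[of \<rho> K]
    by (simp add: class_action_def image_image o_inv_distrib permutes_bij comp_assoc)
  have one: "class_action m n id K = K" if "K \<in> tuple_classes m n" for K
    using that by (simp add: class_action_def)
  have bij: "class_action m n \<sigma> \<in> Bij (tuple_classes m n)" if \<sigma>: "\<sigma> permutes {1..m*n}" for \<sigma>
  proof -
    have "bij_betw (class_action m n \<sigma>) (tuple_classes m n) (tuple_classes m n)"
      by (rule bij_betw_byWitness[where f' = "class_action m n (inv' \<sigma>)"])
        (use \<sigma> mem permutes_inv[OF \<sigma>] comp[OF permutes_inv[OF \<sigma>] \<sigma>]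
          comp[OF \<sigma> permutes_inv[OF \<sigma>]] one permutes_inv_o[OF \<sigma>] in auto)
    then show ?thesis
      by (simp add: Bij_def class_action_def)
  qed
  have "class_action m n \<in> hom (sym_group (m * n)) (BijGroup (tuple_classes m n))"
  proof (rule homI)
    fix \<sigma> \<rho>
    assume "\<sigma> \<in> carrier (sym_group (m * n))" "\<rho> \<in> carrier (sym_group (m * n))"
    then have \<sigma>: "\<sigma> permutes {1..m*n}" and \<rho>: "\<rho> permutes {1..m*n}"
      by (auto simp: sym_group_carrier)
    have "class_action m n (\<sigma> \<circ> \<rho>) =
        compose (tuple_classes m n) (class_action m n \<sigma>) (class_action m n \<rho>)"
      by (rule extensionalityI[where A = "tuple_classes m n"])
        (use comp[OF \<sigma> \<rho>] in \<open>auto simp: class_action_def compose_eq\<close>)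
    then show "class_action m n (\<sigma> \<otimes>\<^bsub>sym_group (m * n)\<^esub> \<rho>) =
        class_action m n \<sigma> \<otimes>\<^bsub>BijGroup (tuple_classes m n)\<^esub> class_action m n \<rho>"
      using bij[OF \<sigma>] bij[OF \<rho>] by (simp add: sym_group_mult BijGroup_def)
  qed (use bij in \<open>simp add: sym_group_carrier BijGroup_def\<close>)
  then show ?thesis
    by (intro group_action.intro group_hom.intro group_hom_axioms.intro
        sym_group_is_group group_BijGroup)
qed

end

theory Submission
  imports Defs "HOL-Computational_Algebra.Formal_Laurent_Series"
begin

text \<open>
  Up to permutation, a tuple is determined by the multiplicities \<open>b\<^sub>0, \<dots>, b\<^bsub>n-1\<^esub>\<close> of its entries
  \<open>n-1, \<dots>, 0\<close>, and the shift rotates \<open>b\<close>. The congruence on the sum of the entries forbids \<open>b\<close> from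
  having a nontrivial rotational period. Hence a class fixed by a permutation \<open>\<sigma>\<close> consists of \<open>n\<close> tuples
  fixed by \<open>\<sigma>\<close>, and Burnside's lemma, applied to tuples paired with functions of content \<open>M\<close>,
  shows that \<open>n\<close> times the coefficient of \<open>M\<close> in the Frobenius characteristic is that of \<open>\<Sum>\<^sub>b h\<^sub>b\<close>.
  On the other side, \<open>b\<close> corresponds to the word \<open>0 1\<^bsup>b\<^sub>0\<^esup> \<dots> 0 1\<^bsup>b\<^bsub>n-1\<^esub>\<^esup>\<close>, both congruences agree, and
  among the \<open>n\<close> distinct rotations of \<open>b\<close> exactly one gives a Lyndon word. The vectors \<open>b\<close> are counted
  by a roots of unity filter, since \<open>\<Prod>\<^bsub>j<n\<^esub> (1 - z\<^sup>j x) = (1 - x\<^sup>e)\<^bsup>n/e\<^esup>\<close> for a primitive \<open>e\<close>-th root of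
  unity \<open>z\<close> with \<open>e\<close> dividing \<open>n\<close>.
\<close>

section \<open>Multiplicity vectors and their rotations\<close>

text \<open>The constant \<open>c_const m n\<close> equals m n (n-1)/2 - (n-1), and its second
  summand is the point. If \<open>b\<close> consists of e > 1 equal pieces, then e divides n and
  \<open>weight b\<close> is congruent to m n (n-1)/2 modulo e, while -(n-1) is congruent to 1, so
  the required congruence fails. This aperiodicity is used twice: each shift class has n elements,
  none of which is a permutation of another, and each \<open>b\<close> has n distinct rotations, of
  which one is Lyndon. Both sides of the identity thus become 1/n times a sum over all
  \<open>b\<close>, and no correspondence between orbits and Lyndon words has to be constructed.

  Functions of content M enter because the coefficient of M in the power sum product of a
  permutation counts the functions that are constant on its cycles and have content M. The Frobenius
  sum is therefore itself a Burnside sum. An orbit of pairs (x, f) is recorded by the multisets of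
  f-values over the sets where x is constant, and the lists of multisets with size vector
  \<open>b\<close> are what the coefficient of M in \<open>h_sym b\<close> counts.\<close>

fun weight :: "nat list \<Rightarrow> nat" where
  "weight [] = 0"
| "weight (x # b) = length b * x + weight b"

lemma weight_append: "weight (b @ c) = weight b + length c * sum_list b + weight c"
  by (induction b) (auto simp: algebra_simps)

text \<open>The factor at position i is the residue that this position stands for, so
  \<open>weight\<close> is the sum of the entries of any tuple with multiplicity vector
  \<open>b\<close>.\<close>

lemma weight_conv_sum: "weight b = (\<Sum>i<length b. (length b - 1 - i) * b ! i)"
proof (induction b)
  case (Cons x b)
  have "(\<Sum>i<length (x # b). (length (x # b) - 1 - i) * (x # b) ! i) =
      length b * x + (\<Sum>i<length b. (length b - 1 - i) * b ! i)"
    by (simp add: sum.lessThan_Suc_shift del: sum.lessThan_Suc)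
  with Cons show ?case by simp
qed simp

definition count_vectors :: "nat \<Rightarrow> nat \<Rightarrow> nat list set" where
  "count_vectors m n = {b. length b = n \<and> sum_list b = m * n \<and>
     [int (weight b) = c_const m n] (mod int n)}"

lemma finite_count_vectors [simp]: "finite (count_vectors m n)"
proof (rule finite_subset)
  show "count_vectors m n \<subseteq> {b. set b \<subseteq> {..m*n} \<and> length b = n}"
    by (auto simp: count_vectors_def dest: member_le_sum_list)
qed (simp add: finite_lists_length_eq)

text \<open>Rotation lowers the factor of the head from \<open>length b - 1\<close> to 0 and raises
  all others by 1. For vectors of length n and sum m n both correction terms are multiples of n, so
  the congruence survives.\<close>

lemma weight_rotate1: "weight (rotate1 b) + length b * hd b = weight b + sum_list b" if "b \<noteq> []"
  using that by (cases b) (auto simp: weight_append algebra_simps)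

lemma mset_rotate [simp]: "mset (rotate k b) = mset b"
proof (induction k)
  case (Suc k)
  have "mset (rotate1 c) = mset c" for c :: "'a list"
    by (cases c) auto
  with Suc show ?case by simp
qed simp

lemma sum_list_rotate1 [simp]: "sum_list (rotate1 b) = sum_list (b :: nat list)"
  by (cases b) auto

lemma rotate1_count_vectors:
  assumes "b \<in> count_vectors m n"
  shows "rotate1 b \<in> count_vectors m n"
proof (cases "b = []")
  case False
  have "int (weight (rotate1 b)) = int (weight b) + int n * (int m - int (hd b))"
    using arg_cong[OF weight_rotate1[OF False], of int] assms
    by (simp add: count_vectors_def algebra_simps)
  then have "[int (weight (rotate1 b)) = int (weight b)] (mod int n)"
    by (simp add: cong_def)
  then show ?thesis
    using assms by (auto simp: count_vectors_def intro: cong_trans)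
qed (use assms in simp)

lemma rotate_count_vectors:
  assumes "b \<in> count_vectors m n"
  shows "rotate k b \<in> count_vectors m n"
  by (induction k) (use assms rotate1_count_vectors in auto)

section \<open>Rotational periods\<close>

lemma rotate_eq_imp_rotate_gcd:
  assumes "rotate k b = b"
  shows "rotate (gcd k (length b)) b = b"
proof -
  have mult: "rotate (j * k) b = b" for j
    by (induction j) (use assms in \<open>auto simp flip: rotate_rotate\<close>)
  have len: "rotate (length b * y + z) b = rotate z b" for y z
    by (metis mod_mult_self4 rotate_conv_mod)
  show ?thesis
  proof (cases "k = 0")
    case False
    \<comment> \<open>Multiples of k and of the length are both periods. Bezout in the form k x =
      length y + gcd stays within the natural numbers.\<close>
    then obtain x y where "k * x = length b * y + gcd k (length b)"
      using bezout_nat by blast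
    then show ?thesis
      using mult[of x] len[of y "gcd k (length b)"] by (simp add: mult.commute)
  qed simp
qed

text \<open>Splitting off u = \<open>take d b\<close> turns invariance under rotation into the
  commutation \<open>v @ u = u @ v\<close>. Hence a nonempty v again begins with u and has period d,
  and the induction goes on.\<close>

lemma rotate_dvd_eq_imp_concat:
  assumes "rotate d b = b" "length b = d * e" "d > 0"
  shows "b = concat (replicate e (take d b))"
  using assms
proof (induction e arbitrary: b)
  case (Suc e)
  define u v where "u = take d b" "v = drop d b"
  have b: "b = u @ v" and lu: "length u = d" and lv: "length v = d * e"
    using Suc.prems by (auto simp: u_v_def)
  have uv: "v @ u = u @ v"
    using Suc.prems(1) rotate_append[of u v] lu by (simp add: b)
  show ?case
  proof (cases "e = 0")
    case True
    then show ?thesis using b lu lv by simp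
  next
    case False
    then have "d \<le> length v"
      using lv by simp
    then have "take d v = u"
      using arg_cong[OF uv, of "take d"] lu by simp
    moreover have "rotate d v = v"
    proof -
      have v: "v = u @ drop d v"
        using \<open>take d v = u\<close> by (metis append_take_drop_id)
      have "rotate d v = drop d v @ u"
        using rotate_append[of u "drop d v"] lu v by metis
      moreover have "u @ drop d v @ u = u @ v"
        using uv v by (metis append_assoc)
      ultimately show ?thesis by simp
    qed
    ultimately have "v = concat (replicate e u)"
      using Suc.IH[of v] lv Suc.prems(3) by simp
    then show ?thesis
      using b lu by simp
  qed
qed simp

text \<open>Each copy has weight \<open>weight u\<close> in itself; every pair of copies adds
  \<open>length u * sum_list u\<close>, because the entries of the earlier copy are counted once for
  each place of the later one.\<close>

lemma weight_concat_replicate: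
  "weight (concat (replicate e u)) = e * weight u + length u * sum_list u * (e choose 2)"
proof (induction e)
  case (Suc e)
  have "Suc e choose 2 = (e choose 2) + e"
    by (simp add: numeral_2_eq_2)
  with Suc show ?case
    by (simp add: weight_append length_concat sum_list_replicate algebra_simps)
qed simp

text \<open>If \<open>b = u\<^sup>e\<close> and \<open>n = e \<cdot> length u\<close>, then \<open>weight b\<close> is congruent to \<open>c_const m n - 1\<close> modulo \<open>e\<close>.\<close>

lemma rotate_count_vectors_neq:
  assumes b: "b \<in> count_vectors m n" and k: "0 < k" "k < n"
  shows "rotate k b \<noteq> b"
proof
  assume "rotate k b = b"
  define d where "d = gcd k n"
  have len: "length b = n" and sum: "sum_list b = m * n"
    and cong: "[int (weight b) = c_const m n] (mod int n)"
    using b by (auto simp: count_vectors_def)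
  have rot: "rotate d b = b"
    using rotate_eq_imp_rotate_gcd[OF \<open>rotate k b = b\<close>] len by (simp add: d_def)
  have d: "0 < d" "d \<le> k"
    using k by (auto simp: d_def gcd_le1_nat)
  obtain e where e: "n = d * e"
    by (metis d_def dvdE gcd_dvd2)
  have e1: "e > 1"
    using e d k by (cases e; cases "e - 1") auto
  define u where "u = take d b"
  have bu: "b = concat (replicate e u)"
    using rotate_dvd_eq_imp_concat[OF rot _ d(1)] len e by (simp add: u_def)
  have lu: "length u = d"
    using len e e1 by (simp add: u_def)
  have "sum_list b = e * sum_list u"
    unfolding bu by (induction e) auto
  then have su: "sum_list u = m * d"
    using sum e e1 by (simp add: mult.commute mult.left_commute)
  have "weight b = e * weight u + d * (m * d) * (e choose 2)"
    using weight_concat_replicate[of e u] by (simp add: bu lu su)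
  moreover have "2 * (e choose 2) = e * (e - 1)"
    by (cases e) (simp_all add: choose_two)
  ultimately have "2 * weight b = 2 * (e * weight u) + d * (m * d) * (e * (e - 1))"
    by (metis distrib_left mult.left_commute)
  \<comment> \<open>All identities are doubled, since \<open>e choose 2\<close> and
    \<open>c_const\<close> contain halves. They are halved again once only even terms are
    left.\<close>
  then have w: "2 * int (weight b) =
      2 * (int e * int (weight u)) + int d * (int m * int d) * (int e * (int e - 1))"
    using e1 by (metis (no_types, opaque_lifting) int_ops(2) int_ops(7) int_plus less_imp_le_nat
        of_nat_diff of_nat_numeral)
  have "even ((int (m * n) - 2) * (int n - 1))"
    by auto
  then have c: "2 * c_const m n = (int (m * n) - 2) * (int n - 1)"
    by (simp add: c_const_def)
  have "even (int d * (int d - 1))"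
    by simp
  then obtain t where t: "int d * (int d - 1) = 2 * t"
    by (elim evenE)
  obtain q where q: "c_const m n = int (weight b) + int n * q"
    using cong by (metis cong_iff_lin)
  have "2 * (int (weight b) + int n * q) = (int m * int d * int e - 2) * (int d * int e - 1)"
    using c q e by simp
  \<comment> \<open>The lone 2 is the product of the -2 in \<open>c_const\<close> and the -1 in n -
    1; every other term is a multiple of 2 e.\<close>
  then have "2 = 2 * (int e * (int (weight u) + int d * q + int d)) -
      int m * int e * (int d * (int d - 1))"
    using w unfolding e of_nat_mult by (simp add: algebra_simps)
  then have "1 = int e * (int (weight u) + int d * q + int d - int m * t)"
    unfolding t by (simp add: algebra_simps)
  then have "int e dvd 1"
    by (metis dvd_triv_left)
  then show False
    using e1 by simp
qed

lemma inj_on_rotate_count_vectors: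
  assumes b: "b \<in> count_vectors m n"
  shows "inj_on (\<lambda>k. rotate k b) {..<n}"
proof -
  have "rotate k b \<noteq> rotate l b" if "k < l" "l < n" for k l
  proof
    assume "rotate k b = rotate l b"
    also have "\<dots> = rotate (l - k) (rotate k b)"
      using that by (simp add: rotate_rotate)
    finally have "rotate (l - k) (rotate k b) = rotate k b" ..
    moreover have "0 < l - k" "l - k < n"
      using that by auto
    ultimately show False
      using rotate_count_vectors_neq[OF rotate_count_vectors[OF b]] by blast
  qed
  then show ?thesis
    by (rule linorder_inj_onI') auto
qed

section \<open>Words and Lyndon words\<close>

text \<open>Empty runs are allowed, so that residues that do not occur in a tuple still occupy a
  place in the word.\<close>

definition gap_word :: "nat list \<Rightarrow> nat list" where
  "gap_word b = concat (map (\<lambda>k. 0 # replicate k 1) b)"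

lemma gap_word_simps [simp]:
  "gap_word [] = []"
  "gap_word (k # b) = 0 # replicate k 1 @ gap_word b"
  "gap_word (b @ c) = gap_word b @ gap_word c"
  by (simp_all add: gap_word_def)

lemma length_gap_word [simp]: "length (gap_word b) = length b + sum_list b"
  by (induction b) auto

lemma gap_word_eq_Nil_iff [simp]: "gap_word b = [] \<longleftrightarrow> b = []"
  by (cases b) auto

lemma gap_word_nth_0: "b \<noteq> [] \<Longrightarrow> gap_word b ! 0 = 0"
  by (cases b) auto

lemma takeWhile_gap_word: "takeWhile (\<lambda>x. x = 1) (replicate k 1 @ gap_word b) = replicate k 1"
  by (cases b) (auto simp: takeWhile_append)

lemma dropWhile_gap_word: "dropWhile (\<lambda>x. x = 1) (replicate k 1 @ gap_word b) = gap_word b"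
  by (cases b) (auto simp: dropWhile_append)

lemma gap_word_inj: "gap_word b = gap_word c \<Longrightarrow> b = c"
proof (induction b arbitrary: c)
  case (Cons k b)
  then obtain l c' where c: "c = l # c'"
    by (cases c) auto
  have eq: "replicate k 1 @ gap_word b = replicate l 1 @ gap_word c'"
    using Cons.prems by (simp add: c)
  from arg_cong[OF eq, of "\<lambda>w. length (takeWhile (\<lambda>x. x = 1) w)"]
  have "k = l" by (simp only: takeWhile_gap_word length_replicate)
  with Cons c show ?case by simp
qed (metis gap_word_eq_Nil_iff)

text \<open>At the right end, a further 0 opens an empty gap and a further 1 lengthens the last gap,
  which exists because the word starts with 0.\<close>

lemma ex_gap_word:
  assumes "set w \<subseteq> {0, 1}" "w = [] \<or> w ! 0 = 0"
  shows "\<exists>b. w = gap_word b"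
  using assms
proof (induction w rule: rev_induct)
  case Nil
  then show ?case by (metis gap_word_simps(1))
next
  case (snoc x w)
  then obtain b where b: "w = gap_word b"
    by (cases w) auto
  show ?case
  proof (cases "x = 0")
    case True
    then have "w @ [x] = gap_word (b @ [0])" by (simp add: b)
    then show ?thesis ..
  next
    case False
    then have x: "x = 1" using snoc.prems by auto
    then have "b \<noteq> []" using snoc.prems b by auto
    then obtain b' k where "b = b' @ [k]" by (metis rev_exhaust)
    then have "w @ [x] = gap_word (b' @ [Suc k])"
      by (simp add: b x replicate_append_same)
    then show ?thesis ..
  qed
qed

lemma count_list_replicate: "count_list (replicate k x) y = (if x = y then k else 0)"
  by (induction k) auto

lemma count_list_gap_word:
  "count_list (gap_word b) 0 = length b" "count_list (gap_word b) 1 = sum_list b"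
  by (induction b) (auto simp: count_list_replicate)

lemma set_gap_word: "set (gap_word b) \<subseteq> {0, 1}"
  by (induction b) auto

text \<open>Empty gaps leave no run. This loss is harmless later, since factors of degree 0 do not
  change a product of complete homogeneous functions.\<close>

lemma one_runs_gap_word: "one_runs (gap_word b) = filter (\<lambda>k. k \<noteq> 0) b"
proof (induction b)
  case (Cons k b)
  show ?case
  proof (cases k)
    case (Suc k')
    have "one_runs (gap_word (k # b)) =
        Suc (length (takeWhile (\<lambda>x. x = 1) (replicate k' 1 @ gap_word b))) #
        one_runs (dropWhile (\<lambda>x. x = 1) (replicate k' 1 @ gap_word b))"
      by (simp add: Suc)
    also have "\<dots> = Suc k' # one_runs (gap_word b)"
      by (simp only: takeWhile_gap_word dropWhile_gap_word length_replicate)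
    finally show ?thesis
      using Cons Suc by simp
  qed (use Cons in simp)
qed simp

lemma sum_positions_snoc:
  "(\<Sum>i | i \<in> {1..length (w @ [x])} \<and> (w @ [x]) ! (i - 1) = 1. int i) =
   (\<Sum>i | i \<in> {1..length w} \<and> w ! (i - 1) = (1::nat). int i) +
   (if x = 1 then int (length w) + 1 else 0)"
proof -
  have 1: "{i. i \<in> {1..length (w @ [x])} \<and> (w @ [x]) ! (i - 1) = 1} =
      {i. i \<in> {1..length w} \<and> w ! (i - 1) = 1} \<union> (if x = 1 then {Suc (length w)} else {})"
    by (auto simp: nth_append)
  show ?thesis
    unfolding 1 by (subst sum.union_disjoint) auto
qed

lemma sum_positions_append_replicate:
  "2 * (\<Sum>i | i \<in> {1..length (w @ replicate k 1)} \<and> (w @ replicate k 1) ! (i - 1) = 1. int i) =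
   2 * (\<Sum>i | i \<in> {1..length w} \<and> w ! (i - 1) = (1::nat). int i) +
   int k * (2 * int (length w) + int k + 1)"
proof (induction k)
  case (Suc k)
  have *: "w @ replicate (Suc k) 1 = (w @ replicate k 1) @ [1]"
    by (simp add: replicate_append_same)
  show ?case
    unfolding * sum_positions_snoc using Suc by (simp add: algebra_simps)
qed simp

text \<open>The zero of rank i stands at position i plus the number of ones before it, and
  \<open>weight b\<close> counts the pairs of a one and a later zero. Subtracting the positions of
  the zeros from those of all letters leaves the ones.\<close>

lemma sum_positions_gap_word:
  "2 * (\<Sum>i | i \<in> {1..length (gap_word b)} \<and> gap_word b ! (i - 1) = 1. int i) =
   int (length (gap_word b)) * (int (length (gap_word b)) + 1) -
   int (length b) * (int (length b) + 1) - 2 * int (weight b)"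
proof (induction b rule: rev_induct)
  case (snoc k b)
  have *: "gap_word (b @ [k]) = (gap_word b @ [0]) @ replicate k 1"
    by simp
  show ?case
    unfolding * sum_positions_append_replicate sum_positions_snoc using snoc
    by (simp add: algebra_simps weight_append)
qed simp

text \<open>The position sum plus 1 equals \<open>c_const m n - int (weight b)\<close> up to a
  multiple of n. The identity is shown after doubling; evenness of m (m+1) makes the multiple
  integral.\<close>

lemma sum_positions_cong_iff:
  assumes "length b = n" "sum_list b = m * n"
  shows "[(\<Sum>i | i \<in> {1..length (gap_word b)} \<and> gap_word b ! (i - 1) = 1. int i) = -1] (mod int n)
    \<longleftrightarrow> [int (weight b) = c_const m n] (mod int n)" (is "[?S = -1] (mod _) \<longleftrightarrow> _")
proof -
  have S: "2 * ?S = (int n + int m * int n) * (int n + int m * int n + 1) -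
      int n * (int n + 1) - 2 * int (weight b)"
    using sum_positions_gap_word[of b] assms by simp
  have "even ((int (m * n) - 2) * (int n - 1))"
    by auto
  then have c: "2 * c_const m n = (int (m * n) - 2) * (int n - 1)"
    by (simp add: c_const_def)
  have "even (int m * (int m + 1))"
    by simp
  then obtain t where t: "int m * (int m + 1) = 2 * t"
    by (elim evenE)
  have "2 * (?S + 1) = 2 * (c_const m n - int (weight b)) +
      int n * (int n * (int m * (int m + 1))) + 2 * (int n * (int m + 1))"
    using S c by (simp add: algebra_simps)
  then have "?S + 1 = (c_const m n - int (weight b)) + int n * (int n * t + int m + 1)"
    unfolding t by (simp add: algebra_simps)
  then have "int n dvd ?S + 1 \<longleftrightarrow> int n dvd c_const m n - int (weight b)"
    by (metis dvd_add_left_iff dvd_triv_left)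
  then show ?thesis
    by (simp add: cong_iff_dvd_diff dvd_diff_commute)
qed

lemma B_words_eq:
  assumes "n > 0"
  shows "B_words m n = gap_word ` count_vectors m n"
proof (intro subset_antisym subsetI)
  fix w assume w: "w \<in> B_words m n"
  then obtain b where b: "w = gap_word b"
    using ex_gap_word[of w] by (auto simp: B_words_def)
  then have "length b = n" "sum_list b = m * n"
    using w count_list_gap_word[of b] by (simp_all add: B_words_def)
  then show "w \<in> gap_word ` count_vectors m n"
    using w sum_positions_cong_iff[of b n m]
    by (auto simp: B_words_def count_vectors_def b)
next
  fix w assume "w \<in> gap_word ` count_vectors m n"
  then obtain b where b: "w = gap_word b" "b \<in> count_vectors m n"
    by blast
  then show "w \<in> B_words m n"
    using sum_positions_cong_iff[of b n m] set_gap_word[of b] count_list_gap_word[of b]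
      gap_word_nth_0[of b] assms
    by (cases "b = []") (auto simp: B_words_def count_vectors_def)
qed

section \<open>Rotations of words and Lyndon representatives\<close>

lemma rotate_gap_word:
  "rotate (length (gap_word (take k b))) (gap_word b) = gap_word (rotate k b)" if "k \<le> length b"
proof -
  have "rotate (length (gap_word (take k b))) (gap_word (take k b) @ gap_word (drop k b)) =
      gap_word (drop k b @ take k b)"
    by (simp only: rotate_append gap_word_simps)
  also have "gap_word (take k b) @ gap_word (drop k b) = gap_word b"
    by (metis append_take_drop_id gap_word_simps(3))
  also have "drop k b @ take k b = rotate k b"
    using that by (cases "k = length b") (auto simp: rotate_drop_take)
  finally show ?thesis .
qed

lemma gap_word_position:
  assumes "j < length (gap_word b)"
  shows "gap_word b ! j = 1 \<or> (\<exists>k<length b. j = length (gap_word (take k b)))"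
  using assms
proof (induction b arbitrary: j)
  case (Cons x b)
  show ?case
  proof (cases "j < Suc x")
    case True
    then show ?thesis
      by (cases j) (auto simp: nth_append intro: exI[of _ 0])
  next
    case False
    then obtain i where i: "j = Suc x + i"
      by (metis add.commute le_Suc_ex not_less)
    then have "i < length (gap_word b)"
      using Cons.prems by simp
    from Cons.IH[OF this] show ?thesis
    proof
      assume "gap_word b ! i = 1"
      then show ?thesis by (simp add: i nth_append)
    next
      assume "\<exists>k<length b. i = length (gap_word (take k b))"
      then obtain k where "k < length b" "i = length (gap_word (take k b))" by blast
      then show ?thesis by (intro disjI2 exI[of _ "Suc k"]) (simp add: i)
    qed
  qed
qed simp

text \<open>A rotation that starts at a one exceeds the word in its first letter, since the word
  starts with 0. The remaining rotations start at a zero and come from rotations of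
  \<open>b\<close>.\<close>

lemma lyndon_gap_word_iff:
  assumes "b \<noteq> []"
  shows "lyndon (gap_word b) \<longleftrightarrow>
    (\<forall>k. 0 < k \<and> k < length b \<longrightarrow> (gap_word b, gap_word (rotate k b)) \<in> lexord less_than)"
proof (intro iffI allI impI)
  fix k assume l: "lyndon (gap_word b)" and k: "0 < k \<and> k < length b"
  let ?j = "length (gap_word (take k b))"
  have "length (gap_word b) = ?j + length (gap_word (drop k b))"
    by (metis append_take_drop_id gap_word_simps(3) length_append)
  then have "0 < ?j" "?j < length (gap_word b)"
    using k assms by auto
  then show "(gap_word b, gap_word (rotate k b)) \<in> lexord less_than"
    using l rotate_gap_word[of k b] k unfolding lyndon_def by (metis less_imp_le)
next
  assume *: "\<forall>k. 0 < k \<and> k < length b \<longrightarrow>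
    (gap_word b, gap_word (rotate k b)) \<in> lexord less_than"
  show "lyndon (gap_word b)"
    unfolding lyndon_def
  proof (intro conjI allI impI)
    fix j assume j: "0 < j \<and> j < length (gap_word b)"
    then have "gap_word b ! j = 1 \<or> (\<exists>k<length b. j = length (gap_word (take k b)))"
      using gap_word_position by blast
    then show "(gap_word b, rotate j (gap_word b)) \<in> lexord less_than"
    proof
      assume "gap_word b ! j = 1"
      with j have "rotate j (gap_word b) = 1 # drop (Suc j) (gap_word b) @ take j (gap_word b)"
        by (simp add: rotate_drop_take Cons_nth_drop_Suc[symmetric])
      then show ?thesis
        using assms by (cases b) auto
    next
      assume "\<exists>k<length b. j = length (gap_word (take k b))"
      then obtain k where k: "k < length b" "j = length (gap_word (take k b))" by blast
      then have "k > 0" using j by (cases k) auto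
      then show ?thesis using * k rotate_gap_word[of k b] by simp
    qed
  qed (use assms in auto)
qed

lemma ex1_lyndon_rotation:
  assumes b: "b \<in> count_vectors m n" and "n > 0"
  shows "\<exists>!k. k < n \<and> lyndon (gap_word (rotate k b))"
proof -
  have len: "length b = n"
    using b by (simp add: count_vectors_def)
  have neq: "b \<noteq> []" using len assms by auto
  have tr: "trans (lexord (less_than :: (nat \<times> nat) set))"
    by (simp add: lexord_trans trans_def)
  have irr: "(w, w) \<notin> lexord (less_than :: (nat \<times> nat) set)" for w
    by (simp add: lexord_irreflexive)
  define f where "f k = gap_word (rotate k b)" for k
  have f_mod: "f (k mod n) = f k" for k
    using rotate_conv_mod[of k b] len by (simp add: f_def)
  have neq_aux: "f k \<noteq> f l" if "k < l" "l < n" for k l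
    using inj_onD[OF inj_on_rotate_count_vectors[OF b], of k l] gap_word_inj that
    by (fastforce simp: f_def)
  have lyn: "lyndon (f k) \<longleftrightarrow> (\<forall>l<n. l \<noteq> k \<longrightarrow> (f k, f l) \<in> lexord less_than)" if k: "k < n" for k
  proof -
    have "lyndon (f k) \<longleftrightarrow> (\<forall>i. 0 < i \<and> i < n \<longrightarrow> (f k, f ((i + k) mod n)) \<in> lexord less_than)"
      unfolding f_mod using lyndon_gap_word_iff[of "rotate k b"] neq len
      by (simp add: f_def rotate_rotate)
    also have "\<dots> \<longleftrightarrow> (\<forall>l<n. l \<noteq> k \<longrightarrow> (f k, f l) \<in> lexord less_than)"
    proof (intro iffI allI impI)
      fix l assume *: "\<forall>i. 0 < i \<and> i < n \<longrightarrow> (f k, f ((i + k) mod n)) \<in> lexord less_than"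
        and l: "l < n" "l \<noteq> k"
      define i where "i = (if k < l then l - k else n + l - k)"
      have "0 < i" "i < n" "(i + k) mod n = l"
        using k l by (auto simp: i_def)
      then show "(f k, f l) \<in> lexord less_than"
        using * by metis
    next
      fix i assume *: "\<forall>l<n. l \<noteq> k \<longrightarrow> (f k, f l) \<in> lexord less_than"
        and i: "0 < i \<and> i < n"
      have "(i + k) mod n \<noteq> k"
        using i k by (cases "i + k < n") (auto simp: le_mod_geq)
      then show "(f k, f ((i + k) mod n)) \<in> lexord less_than"
        using * \<open>n > 0\<close> by simp
    qed
    finally show ?thesis .
  qed
  have total: "f k = f l \<or> (f k, f l) \<in> lexord less_than \<or> (f l, f k) \<in> lexord less_than" for k l
  proof -
    have "\<forall>a b. (a, b) \<in> less_than \<or> a = b \<or> (b, a) \<in> less_than"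
      by auto
    then show ?thesis
      using lexord_linear by blast
  qed
  \<comment> \<open>A strict minimum among the first n' rotations: the next rotation either exceeds
    the old minimum or lies below it and, by transitivity, below all others. Equality is excluded
    since the rotations are distinct.\<close>
  have "\<exists>k<n'. \<forall>l<n'. l \<noteq> k \<longrightarrow> (f k, f l) \<in> lexord less_than" if "0 < n'" "n' \<le> n" for n'
    using that
  proof (induction n')
    case (Suc n')
    show ?case
    proof (cases "n' = 0")
      case False
      then obtain k where k: "k < n'" "\<forall>l<n'. l \<noteq> k \<longrightarrow> (f k, f l) \<in> lexord less_than"
        using Suc by auto
      have "f k \<noteq> f n'" using neq_aux k Suc.prems by simp
      with total[of k n'] consider "(f k, f n') \<in> lexord less_than" | "(f n', f k) \<in> lexord less_than"
        by blast
      then show ?thesis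
      proof cases
        case 1
        then show ?thesis using k by (intro exI[of _ k]) (auto simp: less_Suc_eq)
      next
        case 2
        then have "(f n', f l) \<in> lexord less_than" if "l < n'" for l
          using k that transD[OF tr 2] by (cases "l = k") auto
        then show ?thesis by (intro exI[of _ n']) (auto simp: less_Suc_eq)
      qed
    qed auto
  qed simp
  then obtain k where k: "k < n" "\<forall>l<n. l \<noteq> k \<longrightarrow> (f k, f l) \<in> lexord less_than"
    using \<open>n > 0\<close> by blast
  show ?thesis
  proof (rule ex1I[of _ k])
    show "k < n \<and> lyndon (gap_word (rotate k b))"
      using k lyn[of k] by (simp add: f_def)
  next
    fix l assume "l < n \<and> lyndon (gap_word (rotate l b))"
    then have "l < n" "\<forall>i<n. i \<noteq> l \<longrightarrow> (f l, f i) \<in> lexord less_than"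
      using lyn[of l] by (auto simp: f_def)
    then show "l = k"
      using k transD[OF tr, of "f k" "f l" "f k"] irr by blast
  qed
qed

lemma rotate_bij_betw_count_vectors:
  assumes "k \<le> n"
  shows "bij_betw (rotate k) (count_vectors m n) (count_vectors m n)"
proof (rule bij_betw_byWitness[where f' = "rotate (n - k)"])
  show "\<forall>b\<in>count_vectors m n. rotate (n - k) (rotate k b) = b"
    using assms by (auto simp: rotate_rotate count_vectors_def rotate_id)
  show "\<forall>b\<in>count_vectors m n. rotate k (rotate (n - k) b) = b"
    using assms by (auto simp: rotate_rotate count_vectors_def rotate_id)
qed (auto intro: rotate_count_vectors)

text \<open>The value at \<open>b\<close> is charged to its unique Lyndon rotation. After exchanging
  the sums, each rotation permutes the count vectors, so the n inner sums coincide and only Lyndon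
  words remain.\<close>

lemma sum_count_vectors_eq_sum_BL_words:
  fixes H :: "nat list \<Rightarrow> 'a :: comm_semiring_1"
  assumes "n > 0"
    and H: "\<And>b k. b \<in> count_vectors m n \<Longrightarrow> H (gap_word (rotate k b)) = H (gap_word b)"
  shows "(\<Sum>b\<in>count_vectors m n. H (gap_word b)) = of_nat n * (\<Sum>w\<in>BL_words m n. H w)"
proof -
  let ?A = "count_vectors m n"
  let ?L = "\<lambda>w. if lyndon w then H w else 0"
  have "H (gap_word b) = (\<Sum>k<n. ?L (gap_word (rotate k b)))" if b: "b \<in> ?A" for b
  proof -
    obtain k where k: "k < n" "lyndon (gap_word (rotate k b))"
      and uniq: "\<And>l. l < n \<Longrightarrow> lyndon (gap_word (rotate l b)) \<Longrightarrow> l = k"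
      using ex1_lyndon_rotation[OF b \<open>n > 0\<close>] by blast
    have "(\<Sum>l<n. ?L (gap_word (rotate l b))) = (\<Sum>l<n. if l = k then H (gap_word b) else 0)"
    proof (intro sum.cong refl)
      fix l assume l: "l \<in> {..<n}"
      show "?L (gap_word (rotate l b)) = (if l = k then H (gap_word b) else 0)"
      proof (cases "l = k")
        case True
        show ?thesis
          unfolding True if_P[OF k(2)] if_P[OF refl] by (rule H[OF b])
      next
        case False
        then have "\<not> lyndon (gap_word (rotate l b))"
          using uniq[of l] l by blast
        then show ?thesis
          using False by (simp only: if_False)
      qed
    qed
    then show ?thesis using k by simp
  qed
  then have "(\<Sum>b\<in>?A. H (gap_word b)) = (\<Sum>b\<in>?A. \<Sum>k<n. ?L (gap_word (rotate k b)))"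
    by (rule sum.cong[OF refl])
  also have "\<dots> = (\<Sum>k<n. \<Sum>b\<in>?A. ?L (gap_word (rotate k b)))"
    by (rule sum.swap)
  also have "\<dots> = (\<Sum>k<n. \<Sum>b\<in>?A. ?L (gap_word b))"
    by (rule sum.cong[OF refl])
      (rule sum.reindex_bij_betw[OF rotate_bij_betw_count_vectors], simp)
  also have "\<dots> = of_nat n * (\<Sum>b\<in>?A. ?L (gap_word b))"
    by simp
  also have "(\<Sum>b\<in>?A. ?L (gap_word b)) = (\<Sum>w\<in>B_words m n. ?L w)"
    unfolding B_words_eq[OF \<open>n > 0\<close>]
    by (subst sum.reindex) (auto intro!: inj_onI gap_word_inj)
  also have "\<dots> = (\<Sum>w\<in>BL_words m n. H w)"
    unfolding BL_words_def B_words_eq[OF \<open>n > 0\<close>]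
    by (subst sum.inter_filter) auto
  finally show ?thesis .
qed

section \<open>Counting by roots of unity\<close>

lemma moebius_mu_prime_times:
  assumes "prime p" "\<not> p dvd d"
  shows "moebius_mu (p * d) = - moebius_mu d"
proof -
  have "coprime p d"
    using assms by (simp add: prime_imp_coprime)
  then have "squarefree (p * d) \<longleftrightarrow> squarefree d"
    using assms squarefree_mult_coprime squarefree_multD squarefree_prime by blast
  moreover have "d \<noteq> 0" "p \<noteq> 0"
    using assms by (auto intro: gr0I)
  then have "prime_factors (p * d) = insert p (prime_factors d)"
    using assms by (simp add: prime_factors_product prime_prime_factors)
  moreover have "p \<notin> prime_factors d"
    using assms by auto
  ultimately show ?thesis
    by (simp add: moebius_mu_def)
qed

lemma sum_divisors_moebius_mu:
  assumes "n > 0"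
  shows "(\<Sum>d | d dvd n. moebius_mu d) = (if n = 1 then 1 else 0)"
proof (cases "n = 1")
  case True
  then show ?thesis by (simp add: moebius_mu_def)
next
  case False
  then obtain p where p: "prime p" "p dvd n"
    using prime_factor_nat by blast
  let ?S = "{d. d dvd n \<and> squarefree d}"
  let ?A = "{d\<in>?S. \<not> p dvd d}"
  have fin: "finite {d. d dvd n}"
    using assms by simp
  then have finS: "finite ?S"
    by (rule rev_finite_subset) auto
  have "(\<Sum>d | d dvd n. moebius_mu d) = (\<Sum>d\<in>?S. moebius_mu d)"
    by (rule sum.mono_neutral_right[OF fin]) (auto simp: moebius_mu_def)
  also have "\<dots> = (\<Sum>d\<in>{d\<in>?S. p dvd d}. moebius_mu d) + (\<Sum>d\<in>?A. moebius_mu d)"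
  proof -
    have "?S \<inter> {d. p dvd d} = {d\<in>?S. p dvd d}" "?S - {d. p dvd d} = ?A"
      by auto
    then show ?thesis
      using sum.Int_Diff[OF finS, of moebius_mu "{d. p dvd d}"] by simp
  qed
  \<comment> \<open>The prime p pairs each squarefree divisor d prime to p with p d, which has the
    opposite sign, so the two partial sums cancel.\<close>
  also have "{d\<in>?S. p dvd d} = (\<lambda>d. p * d) ` ?A"
  proof (intro subset_antisym subsetI)
    fix d assume d: "d \<in> {d\<in>?S. p dvd d}"
    then obtain d' where d': "d = p * d'" by blast
    then have "\<not> p dvd d'"
      using d p squarefreeD[of d p] by (auto simp: power2_eq_square)
    moreover have "squarefree d'" "d' dvd n"
      using d d' squarefree_mono[of d' d] by (auto elim: dvd_mult_left dvd_mult_right)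
    ultimately show "d \<in> (\<lambda>d. p * d) ` ?A"
      using d' by blast
  next
    fix d assume "d \<in> (\<lambda>d. p * d) ` ?A"
    then obtain d' where d': "d = p * d'" "d' dvd n" "squarefree d'" "\<not> p dvd d'" by blast
    then have "coprime p d'"
      using p by (simp add: prime_imp_coprime)
    then show "d \<in> {d\<in>?S. p dvd d}"
      using d' p by (auto intro: divides_mult squarefree_mult_coprime squarefree_prime)
  qed
  also have "(\<Sum>d\<in>(\<lambda>d. p * d) ` ?A. moebius_mu d) = (\<Sum>d\<in>?A. - moebius_mu d)"
    by (subst sum.reindex)
      (use p in \<open>auto simp: moebius_mu_prime_times inj_on_def intro!: sum.cong\<close>)
  finally show ?thesis
    using False by (simp add: sum_negf)
qed

text \<open>The indices with gcd d are the multiples d j with j coprime to n/d. The index 0 has gcd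
  n and is covered by d = n with j = 0, which is coprime to 1.\<close>

lemma sum_lessThan_by_gcd:
  fixes f :: "nat \<Rightarrow> 'a :: comm_monoid_add"
  assumes "n > 0"
  shows "(\<Sum>k<n. f k) = (\<Sum>d | d dvd n. \<Sum>j | j < n div d \<and> coprime j (n div d). f (d * j))"
proof -
  have "(\<Sum>d | d dvd n. \<Sum>k\<in>{k\<in>{..<n}. gcd k n = d}. f k) = (\<Sum>k<n. f k)"
    by (rule sum.group) (use assms in auto)
  moreover have "(\<Sum>k\<in>{k\<in>{..<n}. gcd k n = d}. f k) =
      (\<Sum>j | j < n div d \<and> coprime j (n div d). f (d * j))" if d: "d dvd n" for d
  proof -
    obtain e where e: "n = d * e" using d by blast
    with assms have pos: "d > 0" "e > 0" by auto
    have "{k\<in>{..<n}. gcd k n = d} = (\<lambda>j. d * j) ` {j. j < e \<and> coprime j e}"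
    proof (intro subset_antisym subsetI)
      fix k assume k: "k \<in> {k\<in>{..<n}. gcd k n = d}"
      then obtain j where j: "k = d * j"
        by (metis (mono_tags, lifting) dvdE gcd_dvd1 mem_Collect_eq)
      have "gcd (d * j) (d * e) = d"
        using k j e by simp
      then have "gcd j e = 1"
        using pos gcd_mult_distrib_nat[of d j e] by simp
      then show "k \<in> (\<lambda>j. d * j) ` {j. j < e \<and> coprime j e}"
        using k j e pos by (auto simp: coprime_iff_gcd_eq_1)
    next
      fix k assume "k \<in> (\<lambda>j. d * j) ` {j. j < e \<and> coprime j e}"
      then show "k \<in> {k\<in>{..<n}. gcd k n = d}"
        using e pos by (auto simp flip: gcd_mult_distrib_nat simp: coprime_iff_gcd_eq_1)
    qed
    then show ?thesis
      using e pos by (simp add: sum.reindex inj_on_def)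
  qed
  ultimately show ?thesis
    by simp
qed

section \<open>Sums of roots of unity\<close>

lemma cis_eq_1_iff_dvd:
  assumes "n > 0"
  shows "cis (2 * pi * real_of_int a / real n) = 1 \<longleftrightarrow> int n dvd a"
proof
  assume "cis (2 * pi * real_of_int a / real n) = 1"
  then have "cos (2 * pi * real_of_int a / real n) = 1"
    by (metis cis.simps(1) one_complex.simps(1))
  then obtain k :: int where "2 * pi * real_of_int a / real n = 2 * pi * real_of_int k"
    by (auto simp: cos_one_2pi_int mult_ac)
  then have "real_of_int a = real_of_int (k * int n)"
    using assms by (simp add: field_simps)
  then show "int n dvd a"
    by (metis dvd_triv_right of_int_eq_iff)
next
  assume "int n dvd a"
  then obtain k where k: "a = int n * k" by blast
  have "2 * pi * real_of_int a / real n = 2 * pi * real_of_int k"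
    using assms by (simp add: k)
  then show "cis (2 * pi * real_of_int a / real n) = 1"
    by (metis Ints_of_int cis_multiple_2pi)
qed

lemma sum_cis_multiples:
  assumes "n > 0"
  shows "(\<Sum>k<n. cis (2 * pi * real k * real_of_int a / real n)) =
    (if int n dvd a then of_nat n else 0)"
proof -
  define z where "z = cis (2 * pi * real_of_int a / real n)"
  have eq: "cis (2 * pi * real k * real_of_int a / real n) = z ^ k" for k
    by (simp add: z_def DeMoivre mult_ac)
  have "z ^ n = 1"
    unfolding eq[symmetric] using assms cis_multiple_2pi[of "real_of_int a"] by (simp add: mult.assoc)
  then show ?thesis
    unfolding eq using cis_eq_1_iff_dvd[OF assms, of a] geometric_sum[of z n]
    by (cases "z = 1") (auto simp flip: z_def)
qed

text \<open>Sorting all n-th roots of unity by their order shows that the sums over primitive roots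
  have the same divisor sums as the Moebius function. By strong induction all terms but the last
  agree, hence so does the last.\<close>

lemma sum_primitive_roots:
  assumes "n > 0"
  shows "(\<Sum>j | j < n \<and> coprime j n. cis (2 * pi * real j / real n)) = of_int (moebius_mu n)"
  using assms
proof (induction n rule: less_induct)
  case (less n)
  define S where "S n = (\<Sum>j | j < n \<and> coprime j n. cis (2 * pi * real j / real n))" for n
  have fin: "finite {d. d dvd n}"
    using less.prems by simp
  have flip: "(\<Sum>d | d dvd n. f (n div d)) = (\<Sum>d | d dvd n. f d)" for f :: "nat \<Rightarrow> complex"
    by (rule sum.reindex_bij_witness[where i = "\<lambda>d. n div d" and j = "\<lambda>d. n div d"])
      (use less.prems in \<open>auto elim!: dvdE\<close>)
  have "(\<Sum>d | d dvd n. S (n div d)) = (\<Sum>k<n. cis (2 * pi * real k / real n))"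
    unfolding sum_lessThan_by_gcd[OF less.prems] S_def
  proof (intro sum.cong refl)
    fix d j assume "d \<in> {d. d dvd n}"
    then obtain e where e: "n = d * e" by blast
    then show "cis (2 * pi * real j / real (n div d)) = cis (2 * pi * real (d * j) / real n)"
      using less.prems by (simp add: mult_ac)
  qed
  also have "\<dots> = (if n = 1 then 1 else 0)"
    using sum_cis_multiples[OF less.prems, of 1] by (auto simp: zdvd1_eq)
  also have "\<dots> = of_int (\<Sum>d | d dvd n. moebius_mu d)"
    using sum_divisors_moebius_mu[OF less.prems] by simp
  finally have eq: "(\<Sum>d | d dvd n. S d) = (\<Sum>d | d dvd n. of_int (moebius_mu d))"
    unfolding flip by simp
  have "S d = of_int (moebius_mu d)" if "d dvd n" "d \<noteq> n" for d
    using less.IH[of d] that less.prems by (auto simp: S_def dest: dvd_imp_le intro!: dvd_pos_nat)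
  then have "(\<Sum>d\<in>{d. d dvd n} - {n}. S d) = (\<Sum>d\<in>{d. d dvd n} - {n}. of_int (moebius_mu d))"
    by (intro sum.cong) auto
  then have "S n = of_int (moebius_mu n)"
    using eq sum.remove[OF fin, of n S]
      sum.remove[OF fin, of n "\<lambda>d. complex_of_int (moebius_mu d)"] by simp
  then show ?case by (simp add: S_def)
qed

section \<open>Generating function of the weight\<close>

definition weight_fps :: "nat \<Rightarrow> complex \<Rightarrow> complex fps" where
  "weight_fps l z = Abs_fps (\<lambda>N. \<Sum>b | length b = l \<and> sum_list b = N. z ^ weight b)"

lemma finite_compositions [simp]: "finite {b :: nat list. length b = l \<and> sum_list b = N}"
proof (rule finite_subset)
  show "{b. length b = l \<and> sum_list b = N} \<subseteq> {b. set b \<subseteq> {..N} \<and> length b = l}"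
    by (auto dest: member_le_sum_list)
qed (simp add: finite_lists_length_eq)

lemma weight_fps_Suc:
  "weight_fps (Suc l) z = Abs_fps (\<lambda>x. (z ^ l) ^ x) * weight_fps l z"
proof (rule fps_ext)
  fix N
  let ?B = "\<lambda>l N. {b :: nat list. length b = l \<and> sum_list b = N}"
  have "?B (Suc l) N = (\<Union>x\<in>{0..N}. (#) x ` ?B l (N - x))"
    by (auto simp: length_Suc_conv image_iff)
  then have "fps_nth (weight_fps (Suc l) z) N =
      (\<Sum>x=0..N. \<Sum>b\<in>(#) x ` ?B l (N - x). z ^ weight b)"
    unfolding weight_fps_def fps_nth_Abs_fps
    by (simp only:) (rule sum.UNION_disjoint; (intro ballI finite_imageI finite_compositions)?; auto)
  also have "\<dots> = (\<Sum>x=0..N. \<Sum>b\<in>?B l (N - x). z ^ (l * x) * z ^ weight b)"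
    by (rule sum.cong[OF refl]) (simp add: sum.reindex power_add)
  finally show "fps_nth (weight_fps (Suc l) z) N =
      fps_nth (Abs_fps (\<lambda>x. (z ^ l) ^ x) * weight_fps l z) N"
    by (simp add: fps_mult_nth weight_fps_def sum_distrib_left power_mult)
qed

lemma fps_geometric: "Abs_fps (\<lambda>x. (c :: complex) ^ x) * (1 - fps_const c * fps_X) = 1"
proof -
  have "Abs_fps (\<lambda>x. c ^ x) * (1 - fps_const c * fps_X) =
      Abs_fps (\<lambda>x. c ^ x) - fps_const c * (fps_X * Abs_fps (\<lambda>x. c ^ x))"
    by (simp add: algebra_simps)
  also have "\<dots> = 1"
    by (rule fps_ext) (auto simp: fps_X_mult_nth simp flip: power_Suc)
  finally show ?thesis .
qed

text \<open>An entry with factor l contributes the geometric series in z^l X, so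
  \<open>weight_fps n z\<close> generates the complete homogeneous polynomials in 1, z, ...,
  z^(n-1). The product form of the identity avoids dividing power series.\<close>

lemma weight_fps_mult_prod:
  "weight_fps n z * (\<Prod>l<n. 1 - fps_const (z ^ l) * fps_X) = 1"
proof (induction n)
  case 0
  have *: "{b :: nat list. b = [] \<and> sum_list b = N} = (if N = 0 then {[]} else {})" for N
    by auto
  show ?case
    by (rule fps_ext) (simp add: weight_fps_def * )
next
  case (Suc n)
  have "weight_fps (Suc n) z * (\<Prod>l<Suc n. 1 - fps_const (z ^ l) * fps_X) =
      (Abs_fps (\<lambda>x. (z ^ n) ^ x) * (1 - fps_const (z ^ n) * fps_X)) *
      (weight_fps n z * (\<Prod>l<n. 1 - fps_const (z ^ l) * fps_X))"
    unfolding weight_fps_Suc by (simp add: mult_ac)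
  also have "\<dots> = 1"
    unfolding fps_geometric Suc by simp
  finally show ?case .
qed

text \<open>The product is invariant under \<open>x \<mapsto> z x\<close>, so only its extreme coefficients survive, and it
  vanishes at \<open>1\<close>.\<close>

lemma prod_primitive_root_poly:
  fixes z :: complex
  assumes e: "e > 0" and z: "z ^ e = 1" "\<And>i. 0 < i \<Longrightarrow> i < e \<Longrightarrow> z ^ i \<noteq> 1"
  shows "(\<Prod>l<e. [:1, - (z ^ l):]) = 1 - monom 1 e"
proof -
  define q where "q = (\<Prod>l<e. [:1, - (z ^ l):])"
  have "pcompose q [:0, z:] = (\<Prod>l<e. [:1, - (z ^ Suc l):])"
    by (simp add: q_def pcompose_prod pcompose_pCons mult.commute)
  \<comment> \<open>The exponents run from 1 to e after the substitution and from 0 to e - 1 in q.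
    Adding the missing end factor to each side gives the same product; since z^e = 1, the two added
    factors agree and can be cancelled.\<close>
  also have "\<dots> * [:1, - (z ^ 0):] = q * [:1, - (z ^ e):]"
    using prod.lessThan_Suc_shift[of "\<lambda>l. [:1, - (z ^ l):]" e]
      prod.lessThan_Suc[of "\<lambda>l. [:1, - (z ^ l):]" e]
    by (simp only: q_def mult.commute)
  also have "[:1, - (z ^ e):] = [:1, - (z ^ 0):]"
    by (simp add: z)
  finally have inv: "pcompose q [:0, z:] = q"
    by (metis mult_right_cancel one_neq_zero pCons_eq_0_iff)
  have mid: "coeff q i = 0" if "0 < i" "i < e" for i
  proof -
    have "z ^ i * coeff q i = coeff q i"
      by (metis inv coeff_pcompose_linear)
    then show ?thesis
      using z(2)[OF that] by simp
  qed
  have "degree q \<le> (\<Sum>l<e. degree [:1, - (z ^ l):])"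
    unfolding q_def using degree_prod_sum_le[of "{..<e}" "\<lambda>l. [:1, - (z ^ l):]"]
    by (simp add: comp_def)
  also have "\<dots> \<le> (\<Sum>l<e. 1)"
    by (intro sum_mono) simp
  finally have deg: "degree q \<le> e"
    by simp
  have c0: "coeff q 0 = 1"
    by (simp add: q_def coeff_0_prod_list poly_0_coeff_0[symmetric] poly_prod)
  have q: "q = 1 + monom (coeff q e) e"
  proof (rule poly_eqI)
    fix i
    show "coeff q i = coeff (1 + monom (coeff q e) e) i"
      using mid[of i] deg c0 e coeff_eq_0[of q i]
      by (cases "i = 0"; cases "i < e"; cases "i = e") (auto simp: coeff_1)
  qed
  have "poly q 1 = 0"
    unfolding q_def poly_prod by (rule prod_zero) (use e in \<open>auto intro!: bexI[of _ 0]\<close>)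
  moreover have "poly q 1 = 1 + coeff q e"
    by (subst q) (simp add: poly_monom)
  ultimately have "coeff q e = -1"
    by (simp add: add_eq_0_iff)
  then show ?thesis
    using q by (simp add: q_def minus_monom)
qed

lemma prod_primitive_root_fps:
  fixes z :: complex
  assumes e: "e > 0" and z: "z ^ e = 1" "\<And>i. 0 < i \<Longrightarrow> i < e \<Longrightarrow> z ^ i \<noteq> 1"
  shows "(\<Prod>l<d * e. 1 - fps_const (z ^ l) * fps_X) = (1 - fps_X ^ e) ^ d"
proof -
  have *: "(\<Prod>l<e. 1 - fps_const (z ^ l) * fps_X) = 1 - (fps_X ^ e :: complex fps)"
  proof -
    have "(\<Prod>l<e. 1 - fps_const (z ^ l) * fps_X) = fps_of_poly (\<Prod>l<e. [:1, - (z ^ l):])"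
      by (simp add: fps_of_poly_prod fps_of_poly_linear' flip: fps_const_neg)
    also have "(\<Prod>l<e. [:1, - (z ^ l):]) = 1 - monom 1 e"
      by (rule prod_primitive_root_poly[OF e z])
    also have "fps_of_poly (1 - monom (1 :: complex) e) = 1 - fps_X ^ e"
      by (simp only: fps_of_poly_diff fps_of_poly_monom' fps_of_poly_1)
    finally show ?thesis .
  qed
  have "(\<Prod>l\<in>{i * e..<i * e + e}. 1 - fps_const (z ^ l) * fps_X) = 1 - fps_X ^ e" for i
  proof -
    have "z ^ (i * e) = 1"
      by (metis mult.commute power_mult power_one z(1))
    then show ?thesis
      unfolding *[symmetric] prod.atLeastLessThan_shift_0[of _ "i * e" "i * e + e"]
      by (simp add: power_add atLeast0LessThan)
  qed
  then show ?thesis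
    using prod.nat_group[of "\<lambda>l. 1 - fps_const (z ^ l) * fps_X" e d] by simp
qed

lemma weight_fps_primitive_root:
  assumes e: "e > 0" and z: "z ^ e = 1" "\<And>i. 0 < i \<Longrightarrow> i < e \<Longrightarrow> z ^ i \<noteq> 1"
  shows "fps_nth (weight_fps (d * e) z) (m * (d * e)) = of_nat (((m + 1) * d - 1) choose (m * d))"
proof -
  have X0: "fps_nth (fps_X ^ e :: complex fps) 0 = 0"
    using e by simp
  \<comment> \<open>Substituting X^e into the series for z = 1 gives a second inverse of (1 -
    X^e)^d, and inverses are unique. At z = 1 every vector contributes 1, so the coefficient counts
    the vectors with d entries and sum m d.\<close>
  let ?W = "weight_fps d 1 oo fps_X ^ e"
  have "weight_fps d 1 * (1 - fps_X) ^ d = 1"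
    using weight_fps_mult_prod[of d 1] by simp
  then have "(weight_fps d 1 * (1 - fps_X) ^ d) oo fps_X ^ e = 1"
    by simp
  then have 1: "?W * (1 - fps_X ^ e) ^ d = 1"
    using e by (simp add: fps_compose_mult_distrib[OF X0] fps_compose_sub_distrib
        fps_compose_power[OF X0, symmetric])
  have 2: "weight_fps (d * e) z * (1 - fps_X ^ e) ^ d = 1"
    using weight_fps_mult_prod[of "d * e" z] prod_primitive_root_fps[OF e z] by simp
  have "weight_fps (d * e) z = weight_fps (d * e) z * (?W * (1 - fps_X ^ e) ^ d)"
    unfolding 1 by simp
  also have "\<dots> = ?W"
    using 2 by (metis mult.left_commute mult_1_right)
  finally have "fps_nth (weight_fps (d * e) z) (m * (d * e)) = fps_nth (weight_fps d 1) (m * d)"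
    using e by (simp add: fps_nth_compose_X_power)
  also have "\<dots> = of_nat (card {b :: nat list. length b = d \<and> sum_list b = m * d})"
    by (simp add: weight_fps_def)
  also have "\<dots> = of_nat ((m * d + d - 1) choose (m * d))"
    unfolding card_length_sum_list ..
  finally show ?thesis
    by (simp add: algebra_simps)
qed

section \<open>Evaluation of the roots of unity filter\<close>

lemma cis_c_const:
  assumes n: "n > 0"
  shows "cis (- (2 * pi * real k * real_of_int (c_const m n) / real n)) =
    (-1) ^ ((n - 1) * k * m) * cnj (cis (2 * pi * real k / real n))"
proof -
  have "even ((int (m * n) - 2) * (int n - 1))"
    by auto
  then have "2 * c_const m n = (int (m * n) - 2) * (int n - 1)"
    by (simp add: c_const_def)
  then have c: "2 * real_of_int (c_const m n) = (real m * real n - 2) * (real n - 1)"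
    by (simp flip: of_int_eq_iff[where 'a = real])
  then have c': "real_of_int (c_const m n) = (real m * real n - 2) * (real n - 1) / 2"
    by simp
  have nkm: "real ((n - 1) * k * m) = (real n - 1) * real k * real m"
    using n by (simp add: of_nat_diff)
  \<comment> \<open>Since c is m n (n-1)/2 - (n-1), the angle splits into -pi k m (n-1), which gives
    the sign, and 2 pi k (n-1)/n, which up to full turns is -2 pi k/n and gives the
    conjugate.\<close>
  have "- (2 * pi * real k * real_of_int (c_const m n) / real n) =
      real ((n - 1) * k * m) * (- pi) + (- (2 * pi * real k / real n) + 2 * pi * real k)"
    unfolding c' nkm using n by (simp add: field_simps)
  then have "cis (- (2 * pi * real k * real_of_int (c_const m n) / real n)) =
      cis (real ((n - 1) * k * m) * (- pi)) *
      (cis (- (2 * pi * real k / real n)) * cis (2 * pi * real k))"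
    by (simp only: cis_mult)
  also have "cis (2 * pi * real k) = 1"
    by (rule cis_multiple_2pi) simp
  also have "cis (real ((n - 1) * k * m) * (- pi)) = (cis (- pi)) ^ ((n - 1) * k * m)"
    by (simp only: DeMoivre)
  also have "cis (- pi) = -1"
    by (simp add: complex_eq_iff)
  finally show ?thesis
    by (simp add: cis_cnj)
qed

text \<open>The sign depends on the index d j only through d. If n is odd, both exponents are even.
  If n is even and d odd, then e is even and j therefore odd; if n and d are even, so is d
  j.\<close>

lemma minus_one_power_gcd:
  assumes "coprime j e" "n = d * e" "n > 0"
  shows "(-1 :: 'a :: ring_1) ^ ((n - 1) * (d * j) * m) = (-1) ^ (m * (n + d))"
proof -
  have "even ((n - 1) * (d * j)) \<longleftrightarrow> even (n + d)"
    using assms coprime_common_divisor_nat[of j e 2] by (auto simp: even_diff_nat)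
  then have "even ((n - 1) * (d * j) * m) \<longleftrightarrow> even (m * (n + d))"
    by (simp only: even_mult_iff) blast
  then show ?thesis
    by (simp only: minus_one_power_iff)
qed

theorem card_count_vectors:
  assumes n: "n > 0"
  shows "real n * real (card (count_vectors m n)) =
    (\<Sum>d | d dvd n. (-1) ^ (m * (n + d)) * real_of_int (moebius_mu (n div d)) *
      real (((m + 1) * d - 1) choose (m * d)))"
proof -
  let ?B = "{b :: nat list. length b = n \<and> sum_list b = m * n}"
  let ?c = "c_const m n"
  let ?\<omega> = "\<lambda>k. cis (2 * pi * real k / real n)"
  have "complex_of_nat n * of_nat (card (count_vectors m n)) =
      (\<Sum>b\<in>?B. if int n dvd int (weight b) - ?c then of_nat n else 0)"
  proof -
    have "count_vectors m n = {b\<in>?B. int n dvd int (weight b) - ?c}"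
      by (auto simp: count_vectors_def cong_iff_dvd_diff)
    then show ?thesis
      by (simp add: sum.inter_filter[symmetric])
  qed
  also have "\<dots> = (\<Sum>b\<in>?B. \<Sum>k<n. cis (2 * pi * real k * real_of_int (int (weight b) - ?c) / real n))"
    by (simp only: sum_cis_multiples[OF n])
  also have "\<dots> = (\<Sum>k<n. \<Sum>b\<in>?B. cis (2 * pi * real k * real_of_int (int (weight b) - ?c) / real n))"
    by (rule sum.swap)
  also have "\<dots> = (\<Sum>k<n. (-1) ^ ((n - 1) * k * m) * cnj (?\<omega> k) *
      fps_nth (weight_fps n (?\<omega> k)) (m * n))"
  proof (rule sum.cong[OF refl])
    fix k
    have "cis (2 * pi * real k * real_of_int (int (weight b) - ?c) / real n) =
        (-1) ^ ((n - 1) * k * m) * cnj (?\<omega> k) * ?\<omega> k ^ weight b" for b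
    proof -
      have "2 * pi * real k * real_of_int (int (weight b) - ?c) / real n =
          - (2 * pi * real k * real_of_int ?c / real n) +
          real (weight b) * (2 * pi * real k / real n)"
        using n by (simp add: field_simps)
      then have "cis (2 * pi * real k * real_of_int (int (weight b) - ?c) / real n) =
          cis (- (2 * pi * real k * real_of_int ?c / real n)) * ?\<omega> k ^ weight b"
        by (simp only: cis_mult DeMoivre)
      then show ?thesis
        by (simp only: cis_c_const[OF n])
    qed
    then show "(\<Sum>b\<in>?B. cis (2 * pi * real k * real_of_int (int (weight b) - ?c) / real n)) =
        (-1) ^ ((n - 1) * k * m) * cnj (?\<omega> k) * fps_nth (weight_fps n (?\<omega> k)) (m * n)"
      by (simp only: weight_fps_def fps_nth_Abs_fps sum_distrib_left)
  qed
  also have "\<dots> = (\<Sum>d | d dvd n. \<Sum>j | j < n div d \<and> coprime j (n div d).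
      (-1) ^ ((n - 1) * (d * j) * m) * cnj (?\<omega> (d * j)) *
      fps_nth (weight_fps n (?\<omega> (d * j))) (m * n))"
    by (rule sum_lessThan_by_gcd[OF n])
  also have "\<dots> = (\<Sum>d | d dvd n. (-1) ^ (m * (n + d)) * of_int (moebius_mu (n div d)) *
      of_nat (((m + 1) * d - 1) choose (m * d)))"
  proof (rule sum.cong[OF refl])
    fix d assume "d \<in> {d. d dvd n}"
    then obtain e where e: "n = d * e" by blast
    with n have pos: "d > 0" "e > 0" and nd: "n div d = e" by auto
    have \<omega>: "?\<omega> (d * j) = cis (2 * pi * real j / real e)" for j
      using e pos by (simp add: mult_ac)
    have "(\<Sum>j | j < e \<and> coprime j e. (-1) ^ ((n - 1) * (d * j) * m) * cnj (?\<omega> (d * j)) *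
          fps_nth (weight_fps n (?\<omega> (d * j))) (m * n)) =
        (\<Sum>j | j < e \<and> coprime j e. (-1) ^ (m * (n + d)) *
          of_nat (((m + 1) * d - 1) choose (m * d)) * cnj (cis (2 * pi * real j / real e)))"
    proof (rule sum.cong[OF refl])
      fix j assume "j \<in> {j. j < e \<and> coprime j e}"
      then have j: "coprime j e" by simp
      have pow: "?\<omega> (d * j) ^ i = cis (2 * pi * real_of_int (int j * int i) / real e)" for i
        unfolding \<omega> by (simp add: DeMoivre mult_ac)
      \<comment> \<open>As j is coprime to e, the index d j yields a primitive e-th root of unity,
        so the coefficient depends on d alone.\<close>
      have "?\<omega> (d * j) ^ i = 1 \<longleftrightarrow> e dvd i" for i
        unfolding pow cis_eq_1_iff_dvd[OF pos(2)] of_nat_mult[symmetric] int_dvd_int_iff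
        using j by (simp add: coprime_commute coprime_dvd_mult_right_iff)
      then have W: "fps_nth (weight_fps n (?\<omega> (d * j))) (m * n) =
          of_nat (((m + 1) * d - 1) choose (m * d))"
        unfolding e by (intro weight_fps_primitive_root) (use pos in \<open>auto dest: dvd_imp_le\<close>)
      show "(-1) ^ ((n - 1) * (d * j) * m) * cnj (?\<omega> (d * j)) *
            fps_nth (weight_fps n (?\<omega> (d * j))) (m * n) =
          (-1) ^ (m * (n + d)) * of_nat (((m + 1) * d - 1) choose (m * d)) *
            cnj (cis (2 * pi * real j / real e))"
        unfolding minus_one_power_gcd[OF j e n] W unfolding \<omega> by (simp only: mult_ac)
    qed
    also have "\<dots> = (-1) ^ (m * (n + d)) * of_nat (((m + 1) * d - 1) choose (m * d)) *
        cnj (\<Sum>j | j < e \<and> coprime j e. cis (2 * pi * real j / real e))"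
      by (simp only: sum_distrib_left cnj_sum)
    \<comment> \<open>The sum is an integer, so the conjugation that stems from
      \<open>c_const\<close> disappears.\<close>
    also have "cnj (\<Sum>j | j < e \<and> coprime j e. cis (2 * pi * real j / real e)) =
        of_int (moebius_mu e)"
      unfolding sum_primitive_roots[OF pos(2)] by simp
    finally show "(\<Sum>j | j < n div d \<and> coprime j (n div d).
        (-1) ^ ((n - 1) * (d * j) * m) * cnj (?\<omega> (d * j)) *
        fps_nth (weight_fps n (?\<omega> (d * j))) (m * n)) =
      (-1) ^ (m * (n + d)) * of_int (moebius_mu (n div d)) *
        of_nat (((m + 1) * d - 1) choose (m * d))"
      unfolding nd by (simp only: mult_ac)
  qed
  finally have "complex_of_real (real n * real (card (count_vectors m n))) =
    complex_of_real (\<Sum>d | d dvd n. (-1) ^ (m * (n + d)) * real_of_int (moebius_mu (n div d)) *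
      real (((m + 1) * d - 1) choose (m * d)))"
    by simp
  then show ?thesis
    by (simp only: of_real_eq_iff)
qed

section \<open>Coefficients of symmetric functions\<close>

lemma finite_submultisets [simp]: "finite {A. A \<subseteq># M}"
proof (rule finite_subset)
  show "{A. A \<subseteq># M} \<subseteq> mset ` {xs. set xs \<subseteq> set_mset M \<and> length xs \<le> size M}"
  proof
    fix A assume A: "A \<in> {A. A \<subseteq># M}"
    obtain xs where "mset xs = A"
      using ex_mset by blast
    then show "A \<in> mset ` {xs. set xs \<subseteq> set_mset M \<and> length xs \<le> size M}"
      using A set_mset_mono[of A M] size_mset_mono[of A M] by (auto intro!: image_eqI[of _ _ xs])
  qed
qed (simp add: finite_lists_length_le)

text \<open>Complete homogeneous functions and power sums are both indicator series, so one count of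
  ordered decompositions serves for products of either: a predicate prescribes the size of a part,
  or that it repeats a single element a given number of times.\<close>

definition factorizations ::
  "('a multiset \<Rightarrow> bool) list \<Rightarrow> 'a multiset \<Rightarrow> 'a multiset list set" where
  "factorizations Qs M = {Ms. list_all2 (\<lambda>Q X. Q X) Qs Ms \<and> sum_list Ms = M}"

lemma factorizations_Cons:
  "factorizations (Q # Qs) M = (\<Union>A\<in>{A. A \<subseteq># M \<and> Q A}. (#) A ` factorizations Qs (M - A))"
  by (auto simp: factorizations_def list_all2_Cons1 image_iff)

lemma finite_factorizations [simp]: "finite (factorizations Qs M)"
proof (induction Qs arbitrary: M)
  case Nil
  have "factorizations [] M \<subseteq> {[]}"
    by (auto simp: factorizations_def)
  then show ?case
    by (rule finite_subset) simp
next
  case (Cons Q Qs)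
  have "finite {A. A \<subseteq># M \<and> Q A}"
    by (rule finite_subset[OF _ finite_submultisets]) auto
  with Cons show ?case
    by (simp add: factorizations_Cons)
qed

lemma series_prod_indicators:
  "series_prod (map (\<lambda>Q M. if Q M then 1 else 0) Qs) M = of_nat (card (factorizations Qs M))"
proof (induction Qs arbitrary: M)
  case Nil
  have "factorizations [] M = (if M = {#} then {[]} else {})"
    by (auto simp: factorizations_def)
  then show ?case
    by (simp add: series_prod_def series_one_def)
next
  case (Cons Q Qs)
  have fin: "finite {A. A \<subseteq># M \<and> Q A}"
    by (rule finite_subset[OF _ finite_submultisets]) auto
  have "series_prod (map (\<lambda>Q M. if Q M then 1 else 0) (Q # Qs)) M =
      (\<Sum>A | A \<subseteq># M. if Q A then of_nat (card (factorizations Qs (M - A))) else 0)"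
    using Cons by (simp add: series_prod_def series_mult_def if_distrib[of "\<lambda>x. x * _"] cong: if_cong)
  also have "\<dots> = (\<Sum>A | A \<subseteq># M \<and> Q A. of_nat (card (factorizations Qs (M - A))))"
    by (simp only: sum.inter_filter[OF finite_submultisets, symmetric] mem_Collect_eq)
  also have "\<dots> = of_nat (\<Sum>A | A \<subseteq># M \<and> Q A. card ((#) A ` factorizations Qs (M - A)))"
    by (simp add: card_image)
  also have "(\<Sum>A | A \<subseteq># M \<and> Q A. card ((#) A ` factorizations Qs (M - A))) =
      card (factorizations (Q # Qs) M)"
    unfolding factorizations_Cons
    by (rule card_UN_disjoint[symmetric]) (use fin in auto)
  finally show ?case .
qed

lemma factorizations_sizes:
  "factorizations (map (\<lambda>k X. size X = k) b) M = {Ms. map size Ms = b \<and> sum_list Ms = M}"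
proof -
  have "list_all2 (\<lambda>Q X. Q X) (map (\<lambda>k X. size X = k) b) Ms \<longleftrightarrow> map size Ms = b"
    for Ms :: "'a multiset list"
    by (auto simp: list_all2_map1 list_all2_conv_all_nth list_eq_iff_nth_eq)
  then show ?thesis
    unfolding factorizations_def by blast
qed

lemma finite_multiset_compositions [simp]:
  "finite {Ms :: 'a multiset list. map size Ms = b \<and> sum_list Ms = M}"
  unfolding factorizations_sizes[symmetric] by (rule finite_factorizations)

lemma h_sym_eq_card:
  "h_sym b M = of_nat (card {Ms. map size Ms = b \<and> sum_list Ms = M})"
proof -
  have "map homogeneous_sym b =
      map (\<lambda>Q M. if Q M then 1 else 0) (map (\<lambda>k X. size X = k) b)"
    by (simp add: homogeneous_sym_def fun_eq_iff)
  then show ?thesis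
    by (simp only: h_sym_def series_prod_indicators factorizations_sizes)
qed

text \<open>Permuting the parts of a decomposition permutes the prescribed sizes. This gives an
  injection, and exchanging the roles of b and c gives one in the other direction.\<close>

lemma h_sym_mset_cong:
  assumes "mset b = mset c"
  shows "h_sym b = h_sym c"
proof
  fix M
  have le: "card {Ms :: nat multiset list. map size Ms = c \<and> sum_list Ms = M} \<le>
      card {Ms :: nat multiset list. map size Ms = b \<and> sum_list Ms = M}" if bc: "mset b = mset c" for b c
  proof -
    obtain p where p: "p permutes {..<length c}" and b: "permute_list p c = b"
      using mset_eq_permutation[OF bc] .
    show ?thesis
    proof (rule card_inj_on_le[of "permute_list p"])
      show "inj_on (permute_list p) {Ms :: nat multiset list. map size Ms = c \<and> sum_list Ms = M}"
      proof (rule inj_onI)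
        fix Xs Ys :: "nat multiset list"
        assume *: "Xs \<in> {Ms. map size Ms = c \<and> sum_list Ms = M}"
          "Ys \<in> {Ms. map size Ms = c \<and> sum_list Ms = M}" "permute_list p Xs = permute_list p Ys"
        then have len: "length Xs = length c" "length Ys = length c"
          by (metis (mono_tags) length_map mem_Collect_eq)+
        then show "Xs = Ys"
          using list_all2_permute_list_iff[of p Xs "(=)" Ys] *(3) p by (simp add: list.rel_eq)
      qed
      show "permute_list p ` {Ms. map size Ms = c \<and> sum_list Ms = M} \<subseteq>
          {Ms :: nat multiset list. map size Ms = b \<and> sum_list Ms = M}"
      proof safe
        fix Ms :: "nat multiset list" assume c: "c = map size Ms"
        with p have p': "p permutes {..<length Ms}" by simp
        show "map size (permute_list p Ms) = b"
          using b p' by (simp add: c permute_list_map)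
        show "sum_list (permute_list p Ms) = sum_list Ms"
          using p' by (metis mset_permute_list sum_mset_sum_list)
      qed
    qed simp
  qed
  show "h_sym b M = h_sym c M"
    unfolding h_sym_eq_card using le[of b c] le[of c b] assms by simp
qed

lemma series_mult_homogeneous_0: "series_mult (homogeneous_sym 0) g = g"
proof
  fix M
  have "series_mult (homogeneous_sym 0) g M = (\<Sum>A | A \<subseteq># M. if A = {#} then g M else 0)"
    unfolding series_mult_def by (rule sum.cong) (auto simp: homogeneous_sym_def)
  then show "series_mult (homogeneous_sym 0) g M = g M"
    by simp
qed

lemma h_sym_filter: "h_sym (filter (\<lambda>k. k \<noteq> 0) b) = h_sym b"
  by (induction b) (auto simp: h_sym_def series_prod_def series_mult_homogeneous_0)

lemma h_sym_one_runs: "h_sym (sort_noninc (one_runs (gap_word b))) = h_sym b"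
proof -
  have "h_sym (sort_noninc (one_runs (gap_word b))) = h_sym (filter (\<lambda>k. k \<noteq> 0) b)"
    by (rule h_sym_mset_cong) (simp only: sort_noninc_def mset_rev mset_sort one_runs_gap_word)
  then show ?thesis
    by (simp only: h_sym_filter)
qed

lemma image_mset_mset_set_const:
  assumes "\<And>x. x \<in> A \<Longrightarrow> f x = c"
  shows "image_mset f (mset_set A) = replicate_mset (card A) c"
proof -
  have "image_mset f (mset_set A) = image_mset (\<lambda>_. c) (mset_set A)"
    by (rule image_mset_cong) (metis assms elem_mset_set empty_iff mset_set.infinite set_mset_empty)
  then show ?thesis
    by (simp add: image_mset_const_eq)
qed

lemma sum_list_image_mset_blocks:
  assumes "distinct os" "pairwise disjnt (set os)" "\<And>A. A \<in> set os \<Longrightarrow> finite A"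
  shows "sum_list (map (\<lambda>A. image_mset f (mset_set A)) os) = image_mset f (mset_set (\<Union>(set os)))"
  using assms
proof (induction os)
  case (Cons A os)
  then have "A \<inter> \<Union>(set os) = {}"
    by (auto simp: pairwise_insert disjnt_def)
  with Cons show ?case
    by (simp add: mset_set_Union pairwise_insert)
qed simp

text \<open>Selecting one variable for every block amounts to a function that is constant on every
  block, and the monomial selected is the content of that function.\<close>

lemma p_sym_map_card:
  assumes os: "distinct os" "pairwise disjnt (set os)" "\<And>A. A \<in> set os \<Longrightarrow> finite A \<and> A \<noteq> {}"
  shows "p_sym (map card os) M = of_nat (card {f \<in> \<Union>(set os) \<rightarrow>\<^sub>E UNIV.
    (\<forall>A\<in>set os. \<forall>x\<in>A. \<forall>y\<in>A. f x = f y) \<and> image_mset f (mset_set (\<Union>(set os))) = M})"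
    (is "_ = of_nat (card ?F)")
proof -
  let ?Qs = "map (\<lambda>A X. \<exists>i. X = replicate_mset (card A) i) os"
  let ?G = "\<lambda>f. map (\<lambda>A. image_mset f (mset_set A)) os"
  have "map power_sum_sym (map card os) = map (\<lambda>Q M. if Q M then 1 else 0) ?Qs"
    by (simp add: power_sum_sym_def fun_eq_iff)
  then have "p_sym (map card os) M = of_nat (card (factorizations ?Qs M))"
    by (simp only: p_sym_def series_prod_indicators)
  also have "factorizations ?Qs M = ?G ` ?F"
  proof (intro subset_antisym subsetI)
    fix Ms assume Ms: "Ms \<in> factorizations ?Qs M"
    then have len: "length Ms = length os" and sum: "sum_list Ms = M"
      and "\<forall>k<length os. \<exists>i. Ms ! k = replicate_mset (card (os ! k)) i"
      by (auto simp: factorizations_def list_all2_map1 list_all2_conv_all_nth)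
    then obtain v where v: "\<And>k. k < length os \<Longrightarrow> Ms ! k = replicate_mset (card (os ! k)) (v k)"
      by metis
    \<comment> \<open>The index is unique because the blocks are disjoint and listed without
      repetition, so f takes the value \<open>v k\<close> on the k-th block.\<close>
    define f where "f = (\<lambda>x\<in>\<Union>(set os). v (THE k. k < length os \<and> x \<in> os ! k))"
    have f: "f x = v k" if "k < length os" "x \<in> os ! k" for k x
    proof -
      have "(THE k. k < length os \<and> x \<in> os ! k) = k"
      proof (rule the_equality)
        fix l assume "l < length os \<and> x \<in> os ! l"
        then show "l = k"
          using that os(1,2) by (metis disjnt_iff nth_eq_iff_index_eq nth_mem pairwiseD)
      qed (use that in simp)
      moreover have "x \<in> \<Union>(set os)"
        using that nth_mem by blast
      ultimately show ?thesis
        by (simp add: f_def)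
    qed
    have G: "?G f = Ms"
    proof (rule nth_equalityI)
      fix k assume "k < length (?G f)"
      then have k: "k < length os" by simp
      then show "?G f ! k = Ms ! k"
        using image_mset_mset_set_const[of "os ! k" f "v k"] f[OF k] v[OF k] by simp
    qed (simp add: len)
    have const: "\<forall>A\<in>set os. \<forall>x\<in>A. \<forall>y\<in>A. f x = f y"
    proof (intro ballI)
      fix A x y assume "A \<in> set os" "x \<in> A" "y \<in> A"
      then obtain k where k: "k < length os" "x \<in> os ! k" "y \<in> os ! k"
        by (metis in_set_conv_nth)
      show "f x = f y"
        using f[OF k(1,2)] f[OF k(1,3)] by simp
    qed
    moreover have "image_mset f (mset_set (\<Union>(set os))) = M"
      using sum_list_image_mset_blocks[of os f] os G sum by simp
    moreover have "f \<in> \<Union>(set os) \<rightarrow>\<^sub>E UNIV"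
      by (simp add: f_def)
    ultimately show "Ms \<in> ?G ` ?F"
      using G by blast
  next
    fix Ms assume "Ms \<in> ?G ` ?F"
    then obtain f where f: "f \<in> ?F" and Ms: "Ms = ?G f" by blast
    have "sum_list Ms = M"
      unfolding Ms using sum_list_image_mset_blocks[of os f] os f by simp
    moreover have "\<exists>i. image_mset f (mset_set A) = replicate_mset (card A) i" if A: "A \<in> set os" for A
    proof -
      obtain a where "a \<in> A" using A os(3) by blast
      then have "f x = f a" if "x \<in> A" for x
        using f A that \<open>a \<in> A\<close> by blast
      then show ?thesis
        by (intro exI[of _ "f a"] image_mset_mset_set_const)
    qed
    then have "list_all2 (\<lambda>Q X. Q X) ?Qs Ms"
      by (simp add: Ms list_all2_map1 list_all2_map2 list_all2_same)
    ultimately show "Ms \<in> factorizations ?Qs M"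
      by (simp add: factorizations_def)
  qed
  also have "card (?G ` ?F) = card ?F"
  proof (rule card_image, rule inj_onI)
    fix f g assume f: "f \<in> ?F" and g: "g \<in> ?F" and eq: "?G f = ?G g"
    show "f = g"
    proof (rule extensionalityI[of _ "\<Union>(set os)"])
      fix x assume "x \<in> \<Union>(set os)"
      then obtain A where A: "A \<in> set os" "x \<in> A" by blast
      have "image_mset f (mset_set A) = image_mset g (mset_set A)"
        using eq A(1) by (simp add: map_eq_conv)
      then have "f ` A = g ` A"
        using os(3)[OF A(1)] by (metis finite_set_mset_mset_set set_image_mset)
      then obtain y where y: "y \<in> A" "f x = g y"
        using A(2) by blast
      moreover have "g y = g x"
        using g A y(1) by blast
      ultimately show "f x = g x" by simp
    qed (use f g in \<open>auto simp: PiE_def\<close>)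
  qed
  finally show ?thesis .
qed

lemma p_sym_cycle_type:
  assumes \<sigma>: "\<sigma> permutes {1..N}"
  shows "p_sym (cycle_type N \<sigma>) M =
    of_nat (card {f \<in> {1..N} \<rightarrow>\<^sub>E UNIV. f \<circ> \<sigma> = f \<and> image_mset f (mset_set {1..N}) = M})"
proof -
  let ?O = "Orbits.orbit \<sigma> ` {1..N}"
  have perm: "permutation \<sigma>"
    using \<sigma> permutation_permutes by blast
  have sub: "Orbits.orbit \<sigma> x \<subseteq> {1..N}" if "x \<in> {1..N}" for x
    using permutes_orbit_subset[OF \<sigma> that] .
  have self: "x \<in> Orbits.orbit \<sigma> x" for x
    using permutation_self_in_orbit[OF perm] .
  have un: "\<Union>?O = {1..N}"
    using sub self by blast
  obtain os where os: "set os = ?O" "distinct os"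
    using finite_distinct_list[of ?O] by auto
  have "mset (cycle_type N \<sigma>) = mset (map card os)"
    using os by (simp add: cycle_type_def mset_set_set[symmetric] flip: os(1))
  \<comment> \<open>\<open>cycle_type\<close> keeps only the orbit sizes, so the list of orbits is
    permuted until its sizes appear in that order.\<close>
  then obtain p where p: "p permutes {..<length os}"
    "permute_list p (map card os) = cycle_type N \<sigma>"
    using mset_eq_permutation by (metis length_map)
  define ps where "ps = permute_list p os"
  have ps: "set ps = ?O" "distinct ps" "cycle_type N \<sigma> = map card ps"
    using os p by (auto simp: ps_def permute_list_map)
  have "pairwise disjnt (set ps)"
    unfolding ps(1) pairwise_def disjnt_iff
    using cyclic_on_orbit'[OF perm] orbit_cyclic_eq3 by (metis imageE)
  moreover have "finite A \<and> A \<noteq> {}" if "A \<in> set ps" for A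
    using that sub self unfolding ps(1) by (metis empty_iff finite_atLeastAtMost finite_subset imageE)
  ultimately have "p_sym (cycle_type N \<sigma>) M = of_nat (card {f \<in> {1..N} \<rightarrow>\<^sub>E UNIV.
      (\<forall>A\<in>?O. \<forall>x\<in>A. \<forall>y\<in>A. f x = f y) \<and> image_mset f (mset_set {1..N}) = M})"
    unfolding ps(3) using p_sym_map_card[OF ps(2), of M] unfolding ps(1) un by blast
  also have "(\<forall>A\<in>?O. \<forall>x\<in>A. \<forall>y\<in>A. f x = f y) \<longleftrightarrow> f \<circ> \<sigma> = f"
    if f: "f \<in> {1..N} \<rightarrow>\<^sub>E (UNIV :: nat set)" for f
  proof
    assume *: "\<forall>A\<in>?O. \<forall>x\<in>A. \<forall>y\<in>A. f x = f y"
    show "f \<circ> \<sigma> = f"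
    proof
      fix x
      show "(f \<circ> \<sigma>) x = f x"
      proof (cases "x \<in> {1..N}")
        case True
        then show ?thesis
          using * self[of x] orbit.base[of \<sigma> x] by (metis comp_apply imageI)
      next
        case False
        then show ?thesis
          using permutes_not_in[OF \<sigma>] by simp
      qed
    qed
  next
    assume *: "f \<circ> \<sigma> = f"
    have "f y = f x" if "y \<in> Orbits.orbit \<sigma> x" for x y
      using that by induction (use * in \<open>auto simp: fun_eq_iff\<close>)
    then show "\<forall>A\<in>?O. \<forall>x\<in>A. \<forall>y\<in>A. f x = f y"
      by (metis imageE)
  qed
  then have "{f \<in> {1..N} \<rightarrow>\<^sub>E (UNIV :: nat set). (\<forall>A\<in>?O. \<forall>x\<in>A. \<forall>y\<in>A. f x = f y) \<and>
      image_mset f (mset_set {1..N}) = M} =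
    {f \<in> {1..N} \<rightarrow>\<^sub>E UNIV. f \<circ> \<sigma> = f \<and> image_mset f (mset_set {1..N}) = M}"
    by blast
  finally show ?thesis .
qed

section \<open>Tuples and their classes\<close>

text \<open>Right actions, since permutations act on tuples by precomposition.\<close>

lemma sum_card_fixed_points:
  fixes act :: "('a \<Rightarrow> 'a) \<Rightarrow> 't \<Rightarrow> 't"
  assumes fin: "finite E" "finite T"
    and maps: "\<And>p t. p permutes E \<Longrightarrow> t \<in> T \<Longrightarrow> act p t \<in> T"
    and comp: "\<And>p q t. p permutes E \<Longrightarrow> q permutes E \<Longrightarrow> t \<in> T \<Longrightarrow> act p (act q t) = act (q \<circ> p) t"
    and key: "\<And>t u. t \<in> T \<Longrightarrow> u \<in> T \<Longrightarrow> key t = key u \<longleftrightarrow> (\<exists>p. p permutes E \<and> act p t = u)"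
  shows "(\<Sum>p | p permutes E. card {t \<in> T. act p t = t}) = fact (card E) * card (key ` T)"
proof -
  let ?P = "{p. p permutes E}"
  have finP: "finite ?P"
    using fin(1) by (rule finite_permutations)
  have "(\<Sum>p\<in>?P. card {t \<in> T. act p t = t}) = (\<Sum>p\<in>?P. \<Sum>t\<in>T. if act p t = t then 1 else 0)"
    using fin(2) by (simp add: sum.If_cases Int_def)
  also have "\<dots> = (\<Sum>t\<in>T. \<Sum>p\<in>?P. if act p t = t then 1 else 0)"
    by (rule sum.swap)
  also have "\<dots> = (\<Sum>t\<in>T. card {p \<in> ?P. act p t = t})"
    using finP by (simp add: sum.If_cases Int_def)
  \<comment> \<open>Equal keys mean the same orbit, so this groups by orbits; each orbit will
    contribute the number of all permutations.\<close>
  also have "\<dots> = (\<Sum>c\<in>key ` T. \<Sum>t\<in>{t\<in>T. key t = c}. card {p \<in> ?P. act p t = t})"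
    by (rule sum.image_gen[OF fin(2)])
  also have "\<dots> = (\<Sum>c\<in>key ` T. fact (card E))"
  proof (rule sum.cong[OF refl])
    fix c assume "c \<in> key ` T"
    then obtain t0 where t0: "t0 \<in> T" "c = key t0" by blast
    \<comment> \<open>If q carries t0 to t, composing with q turns the stabilizer of t into the set
      of permutations carrying t0 to t. These sets partition all permutations as t runs through the
      orbit.\<close>
    have stab: "card {p \<in> ?P. act p t = t} = card {p \<in> ?P. act p t0 = t}"
      if t: "t \<in> {t\<in>T. key t = c}" for t
    proof -
      obtain q where q: "q permutes E" "act q t0 = t"
        using key[of t0 t] t t0 by auto
      have "bij_betw (\<lambda>p. q \<circ> p) {p \<in> ?P. act p t = t} {p \<in> ?P. act p t0 = t}"
      proof (rule bij_betw_byWitness[where f' = "\<lambda>p. inv' q \<circ> p"])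
        show "(\<lambda>p. q \<circ> p) ` {p \<in> ?P. act p t = t} \<subseteq> {p \<in> ?P. act p t0 = t}"
          using comp[OF _ q(1) t0(1)] q by (auto simp: permutes_compose)
        have "act (inv' q \<circ> p) t = t" if "p permutes E" "act p t0 = t" for p
          using comp[of "inv' q \<circ> p" q t0] q t0 that
          by (simp add: permutes_compose permutes_inv o_assoc permutes_inv_o)
        then show "(\<lambda>p. inv' q \<circ> p) ` {p \<in> ?P. act p t0 = t} \<subseteq> {p \<in> ?P. act p t = t}"
          using q by (auto intro: permutes_compose permutes_inv)
      qed (use q in \<open>auto simp: o_assoc permutes_inv_o\<close>)
      then show ?thesis
        by (rule bij_betw_same_card)
    qed
    have "(\<Sum>t\<in>{t\<in>T. key t = c}. card {p \<in> ?P. act p t = t}) =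
        (\<Sum>t\<in>{t\<in>T. key t = c}. card {p \<in> ?P. act p t0 = t})"
      by (rule sum.cong[OF refl stab])
    also have "\<dots> = card (\<Union>t\<in>{t\<in>T. key t = c}. {p \<in> ?P. act p t0 = t})"
      by (rule card_UN_disjoint[symmetric]) (use fin(2) finP in auto)
    also have "(\<Union>t\<in>{t\<in>T. key t = c}. {p \<in> ?P. act p t0 = t}) = ?P"
      using maps[OF _ t0(1)] key[OF t0(1)] t0(2) by fastforce
    also have "card ?P = fact (card E)"
      using fin(1) by (rule card_permutations[OF refl])
    finally show "(\<Sum>t\<in>{t\<in>T. key t = c}. card {p \<in> ?P. act p t = t}) = fact (card E)" .
  qed
  finally show ?thesis
    by simp
qed

section \<open>Blocks of equal entries as orbit invariants\<close>

definition residues_desc :: "nat \<Rightarrow> int list" where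
  "residues_desc n = map (\<lambda>i. int n - 1 - int i) [0..<n]"

lemma residues_desc_props [simp]:
  "length (residues_desc n) = n" "distinct (residues_desc n)" "set (residues_desc n) = {0..int n - 1}"
proof -
  show "set (residues_desc n) = {0..int n - 1}"
  proof (intro subset_antisym subsetI)
    fix v assume "v \<in> {0..int n - 1}"
    then show "v \<in> set (residues_desc n)"
      by (auto simp: residues_desc_def image_iff intro!: bexI[of _ "nat (int n - 1 - v)"])
  qed (auto simp: residues_desc_def)
qed (auto simp: residues_desc_def distinct_map inj_on_def)

lemma residues_desc_nth: "i < n \<Longrightarrow> residues_desc n ! i = int n - 1 - int i"
  by (simp add: residues_desc_def)

lemma sum_list_map_size: "sum_list (map size Ms) = size (sum_list (Ms :: 'a multiset list))"
  by (induction Ms) auto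

definition blocks :: "nat \<Rightarrow> nat set \<Rightarrow> (nat \<Rightarrow> int) \<Rightarrow> (nat \<Rightarrow> 'a) \<Rightarrow> 'a multiset list" where
  "blocks n E x f = map (\<lambda>v. image_mset f (mset_set {j\<in>E. x j = v})) (residues_desc n)"

definition count_vector :: "nat \<Rightarrow> nat set \<Rightarrow> (nat \<Rightarrow> int) \<Rightarrow> nat list" where
  "count_vector n E x = map (\<lambda>v. card {j\<in>E. x j = v}) (residues_desc n)"

lemma nth_blocks:
  "i < n \<Longrightarrow> blocks n E x f ! i = image_mset f (mset_set {j\<in>E. x j = int n - 1 - int i})"
  by (simp add: blocks_def residues_desc_nth)

lemma nth_count_vector:
  "i < n \<Longrightarrow> count_vector n E x ! i = card {j\<in>E. x j = int n - 1 - int i}"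
  by (simp add: count_vector_def residues_desc_nth)

lemma length_count_vector [simp]: "length (count_vector n E x) = n"
  by (simp add: count_vector_def)

lemma map_size_blocks: "map size (blocks n E x f) = count_vector n E x"
  by (simp add: blocks_def count_vector_def comp_def)

lemma sum_list_image_mset_fibres:
  assumes "finite E" "distinct vs"
  shows "sum_list (map (\<lambda>v. image_mset f (mset_set {j\<in>E. x j = v})) vs) =
    image_mset f (mset_set {j\<in>E. x j \<in> set vs})"
  using assms(2)
proof (induction vs)
  case (Cons v vs)
  have "{j\<in>E. x j \<in> set (v # vs)} = {j\<in>E. x j = v} \<union> {j\<in>E. x j \<in> set vs}"
    by auto
  then have "mset_set {j\<in>E. x j \<in> set (v # vs)} =
      mset_set {j\<in>E. x j = v} + mset_set {j\<in>E. x j \<in> set vs}"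
    using assms(1) Cons.prems by (simp only:) (rule mset_set_Union; auto)
  with Cons show ?case
    by simp
qed simp

lemma sum_list_blocks:
  assumes "finite E" "x \<in> E \<rightarrow> {0..int n - 1}"
  shows "sum_list (blocks n E x f) = image_mset f (mset_set E)"
proof -
  have "{j\<in>E. x j \<in> set (residues_desc n)} = E"
    using assms(2) by auto
  then show ?thesis
    unfolding blocks_def sum_list_image_mset_fibres[OF assms(1) residues_desc_props(2)] by simp
qed

lemma sum_list_count_vector:
  assumes "finite E" "x \<in> E \<rightarrow> {0..int n - 1}"
  shows "sum_list (count_vector n E x) = card E"
proof -
  have "sum_list (count_vector n E x) = size (sum_list (blocks n E x id))"
    unfolding map_size_blocks[of n E x id, symmetric] by (rule sum_list_map_size)
  then show ?thesis
    by (simp add: sum_list_blocks[OF assms])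
qed

lemma weight_count_vector:
  assumes "finite E" "x \<in> E \<rightarrow> {0..int n - 1}"
  shows "int (weight (count_vector n E x)) = (\<Sum>j\<in>E. x j)"
proof -
  have "(\<Sum>j\<in>E. x j) = (\<Sum>v\<in>{0..int n - 1}. \<Sum>j\<in>{j\<in>E. x j = v}. x j)"
    by (rule sum.group[symmetric]) (use assms in auto)
  also have "\<dots> = (\<Sum>v\<in>{0..int n - 1}. v * int (card {j\<in>E. x j = v}))"
    by (rule sum.cong) auto
  also have "\<dots> = (\<Sum>i<n. (int n - 1 - int i) * int (card {j\<in>E. x j = int n - 1 - int i}))"
    by (rule sum.reindex_bij_witness[where i = "\<lambda>i. int n - 1 - int i" and j = "\<lambda>v. nat (int n - 1 - v)"])
      auto
  also have "\<dots> = int (\<Sum>i<n. (n - 1 - i) * card {j\<in>E. x j = int n - 1 - int i})"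
    unfolding of_nat_sum
  proof (rule sum.cong[OF refl])
    fix i assume "i \<in> {..<n}"
    then have "int (n - 1 - i) = int n - 1 - int i"
      by auto
    then show "(int n - 1 - int i) * int (card {j\<in>E. x j = int n - 1 - int i}) =
        int ((n - 1 - i) * card {j\<in>E. x j = int n - 1 - int i})"
      by (simp only: of_nat_mult)
  qed
  also have "(\<Sum>i<n. (n - 1 - i) * card {j\<in>E. x j = int n - 1 - int i}) = weight (count_vector n E x)"
    unfolding weight_conv_sum
    by (rule sum.cong) (simp_all add: count_vector_def residues_desc_nth)
  finally show ?thesis ..
qed

lemma count_image_mset_mset_set:
  "finite A \<Longrightarrow> count (image_mset h (mset_set A)) z = card {a\<in>A. h a = z}"
  by (simp add: count_conv_size_mset filter_mset_image_mset comp_def filter_mset_mset_set)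

text \<open>Two pairs differ by a permutation exactly if the multisets of the values (x j, f j)
  agree, and \<open>blocks\<close> is that multiset split by the first component.\<close>

lemma blocks_eq_iff:
  assumes E: "finite E"
    and x: "x \<in> E \<rightarrow>\<^sub>E {0..int n - 1}" and y: "y \<in> E \<rightarrow>\<^sub>E {0..int n - 1}"
    and f: "f \<in> E \<rightarrow>\<^sub>E UNIV" and g: "g \<in> E \<rightarrow>\<^sub>E UNIV"
  shows "blocks n E x f = blocks n E y g \<longleftrightarrow> (\<exists>p. p permutes E \<and> x \<circ> p = y \<and> f \<circ> p = g)"
proof
  assume eq: "blocks n E x f = blocks n E y g"
  have "image_mset (\<lambda>j. (y j, g j)) (mset_set E) = image_mset (\<lambda>j. (x j, f j)) (mset_set E)"
  proof (rule multiset_eqI)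
    fix z :: "int \<times> 'a"
    obtain v u where z: "z = (v, u)" by (cases z)
    show "count (image_mset (\<lambda>j. (y j, g j)) (mset_set E)) z =
        count (image_mset (\<lambda>j. (x j, f j)) (mset_set E)) z"
    proof (cases "v \<in> {0..int n - 1}")
      case True
      then have "image_mset f (mset_set {j\<in>E. x j = v}) = image_mset g (mset_set {j\<in>E. y j = v})"
        using eq by (simp add: blocks_def)
      then have "count (image_mset f (mset_set {j\<in>E. x j = v})) u =
          count (image_mset g (mset_set {j\<in>E. y j = v})) u"
        by (rule arg_cong)
      then have "card {j\<in>{j\<in>E. x j = v}. f j = u} = card {j\<in>{j\<in>E. y j = v}. g j = u}"
        using E by (simp only: count_image_mset_mset_set finite_Collect_conjI Collect_mem_eq simp_thms finite_Int)
      then show ?thesis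
        using E by (simp add: z count_image_mset_mset_set conj_assoc)
    next
      case False
      then have empty: "{j\<in>E. (y j, g j) = z} = {}" "{j\<in>E. (x j, f j) = z} = {}"
        using x y by (auto simp: z)
      show ?thesis
        by (simp only: count_image_mset_mset_set[OF E] empty)
    qed
  qed
  then obtain p where p: "p permutes E" "\<forall>j\<in>E. (y j, g j) = (x (p j), f (p j))"
    using image_mset_eq_implies_permutes[OF E] by blast
  \<comment> \<open>Outside E all four functions have the value \<open>undefined\<close>, and p
    fixes these points.\<close>
  have "x (p j) = y j \<and> f (p j) = g j" for j
  proof (cases "j \<in> E")
    case False
    then show ?thesis
      using permutes_not_in[OF p(1) False] PiE_arb[OF x False] PiE_arb[OF y False]
        PiE_arb[OF f False] PiE_arb[OF g False] by simp
  qed (use p(2) in auto)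
  then have "x \<circ> p = y" "f \<circ> p = g"
    by auto
  then show "\<exists>p. p permutes E \<and> x \<circ> p = y \<and> f \<circ> p = g"
    using p by blast
next
  assume "\<exists>p. p permutes E \<and> x \<circ> p = y \<and> f \<circ> p = g"
  then obtain p where p: "p permutes E" "y = x \<circ> p" "g = f \<circ> p" by blast
  have "image_mset g (mset_set {j\<in>E. y j = v}) = image_mset f (mset_set {j\<in>E. x j = v})" for v
  proof -
    have "p ` {j\<in>E. y j = v} = {j\<in>E. x j = v}"
      using p permutes_image[OF p(1)] by auto
    moreover have "image_mset p (mset_set {j\<in>E. y j = v}) = mset_set (p ` {j\<in>E. y j = v})"
      by (rule image_mset_mset_set) (metis inj_on_subset permutes_inj p(1) subset_UNIV)
    ultimately show ?thesis
      unfolding p(3) by (metis multiset.map_comp)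
  qed
  then show "blocks n E x f = blocks n E y g"
    by (simp add: blocks_def)
qed

text \<open>With functions into the unit type a block carries nothing but its size, so this is an
  instance of the statement for pairs.\<close>

lemma count_vector_eq_iff:
  assumes E: "finite E"
    and x: "x \<in> E \<rightarrow>\<^sub>E {0..int n - 1}" and y: "y \<in> E \<rightarrow>\<^sub>E {0..int n - 1}"
  shows "count_vector n E x = count_vector n E y \<longleftrightarrow> (\<exists>p. p permutes E \<and> x \<circ> p = y)"
proof -
  let ?f = "\<lambda>j\<in>E. ()"
  have b: "blocks n E x ?f = map (\<lambda>k. replicate_mset k ()) (count_vector n E x)" for x
    unfolding blocks_def count_vector_def map_map
    by (rule map_cong[OF refl]) (simp add: image_mset_mset_set_const)
  have "inj_on (\<lambda>k. replicate_mset k ()) A" for A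
    by (rule inj_onI) (metis size_replicate_mset)
  then have "count_vector n E x = count_vector n E y \<longleftrightarrow> blocks n E x ?f = blocks n E y ?f"
    unfolding b by (metis inj_map_eq_map)
  also have "\<dots> \<longleftrightarrow> (\<exists>p. p permutes E \<and> x \<circ> p = y \<and> ?f \<circ> p = ?f)"
    by (rule blocks_eq_iff[OF E x y]) auto
  also have "\<dots> \<longleftrightarrow> (\<exists>p. p permutes E \<and> x \<circ> p = y)"
    by (auto simp: fun_eq_iff)
  finally show ?thesis .
qed

text \<open>Every element of the i-th multiset is tagged with the residue of position i. Any
  enumeration of the tagged elements yields x as the tags and f as the elements.\<close>

lemma ex_blocks:
  fixes Ms :: "'a multiset list"
  assumes len: "length Ms = n" and size: "size (sum_list Ms) = N"
  obtains x and f :: "nat \<Rightarrow> 'a" where "x \<in> {1..N} \<rightarrow>\<^sub>E {0..int n - 1}" "f \<in> {1..N} \<rightarrow>\<^sub>E UNIV"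
    "blocks n {1..N} x f = Ms"
proof -
  define G where "G = sum_list (map (\<lambda>i. image_mset (Pair (int n - 1 - int i)) (Ms ! i)) [0..<n])"
  have "size G = size (sum_list (map (\<lambda>i. Ms ! i) [0..<n]))"
    unfolding G_def by (simp add: sum_list_map_size[symmetric] comp_def)
  also have "map (\<lambda>i. Ms ! i) [0..<n] = Ms"
    using len by (metis map_nth)
  finally have sizeG: "size G = N"
    using size by simp
  obtain l where l: "mset l = G"
    using ex_mset by blast
  have lenl: "length l = N"
    using sizeG l by (metis size_mset)
  let ?h = "\<lambda>j. l ! (j - 1)"
  have h: "image_mset ?h (mset_set {1..N}) = G"
  proof -
    have "mset l = image_mset (\<lambda>i. l ! i) (mset_set {0..<N})"
      by (metis lenl map_nth mset_map mset_upt atLeast_upt)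
    also have "mset_set {0..<N} = image_mset (\<lambda>j. j - 1) (mset_set {1..N})"
    proof -
      have "(\<lambda>j. j - 1) ` {1..N} = {0..<N}"
        by (auto simp: image_iff intro!: bexI[of _ "Suc _"])
      then show ?thesis
        by (subst image_mset_mset_set) (auto simp: inj_on_def)
    qed
    finally show ?thesis
      using l by (simp add: image_mset.compositionality comp_def)
  qed
  have mem: "?h j \<in># G" if "j \<in> {1..N}" for j
    using that by (subst h[symmetric]) auto
  have G_fst: "fst z \<in> {0..int n - 1}" if "z \<in># G" for z
    using that by (auto simp: G_def set_mset_sum_list)
  have filt: "image_mset snd (filter_mset (\<lambda>z. fst z = int n - 1 - int i) G) = Ms ! i" if i: "i < n" for i
  proof -
    have pair: "image_mset snd (filter_mset (\<lambda>z. fst z = v) (image_mset (Pair w) X)) =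
        (if w = v then X else {#})" for v w :: int and X :: "'a multiset"
      by (simp add: filter_mset_image_mset comp_def image_mset.compositionality)
    have "image_mset snd (filter_mset (\<lambda>z. fst z = int n - 1 - int i)
        (sum_list (map (\<lambda>i. image_mset (Pair (int n - 1 - int i)) (Ms ! i)) [0..<k]))) =
        (if i < k then Ms ! i else {#})" for k
      by (induction k) (auto simp: pair less_Suc_eq)
    then show ?thesis
      using i by (simp add: G_def)
  qed
  show thesis
  proof (rule that[of "\<lambda>j\<in>{1..N}. fst (?h j)" "\<lambda>j\<in>{1..N}. snd (?h j)"])
    show "(\<lambda>j\<in>{1..N}. fst (?h j)) \<in> {1..N} \<rightarrow>\<^sub>E {0..int n - 1}"
      using G_fst mem by (auto simp: restrict_def PiE_def Pi_def extensional_def)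
    show "blocks n {1..N} (\<lambda>j\<in>{1..N}. fst (?h j)) (\<lambda>j\<in>{1..N}. snd (?h j)) = Ms"
    proof (rule nth_equalityI)
      fix i assume "i < length (blocks n {1..N} (\<lambda>j\<in>{1..N}. fst (?h j)) (\<lambda>j\<in>{1..N}. snd (?h j)))"
      then have i: "i < n" by (simp add: blocks_def)
      let ?J = "{j\<in>{1..N}. fst (?h j) = int n - 1 - int i}"
      have J: "{j\<in>{1..N}. (\<lambda>j\<in>{1..N}. fst (?h j)) j = int n - 1 - int i} = ?J"
        by auto
      have "image_mset (\<lambda>j\<in>{1..N}. snd (?h j)) (mset_set ?J) = image_mset snd (image_mset ?h (mset_set ?J))"
        unfolding image_mset.compositionality by (rule image_mset_cong) auto
      also have "mset_set ?J = filter_mset (\<lambda>j. fst (?h j) = int n - 1 - int i) (mset_set {1..N})"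
        by (simp add: filter_mset_mset_set)
      also have "image_mset ?h \<dots> = filter_mset (\<lambda>z. fst z = int n - 1 - int i) G"
        unfolding h[symmetric] by (simp add: filter_mset_image_mset comp_def)
      finally have eq: "image_mset (\<lambda>j\<in>{1..N}. snd (?h j)) (mset_set ?J) =
          image_mset snd (filter_mset (\<lambda>z. fst z = int n - 1 - int i) G)"
        by (simp only: filter_mset_mset_set finite_atLeastAtMost)
      show "blocks n {1..N} (\<lambda>j\<in>{1..N}. fst (?h j)) (\<lambda>j\<in>{1..N}. snd (?h j)) ! i = Ms ! i"
        unfolding nth_blocks[OF i] J eq by (rule filt[OF i])
    qed (simp add: blocks_def len)
  qed auto
qed

lemma tuplesD:
  assumes "x \<in> tuples m n"
  shows "x \<in> {1..m*n} \<rightarrow>\<^sub>E {0..int n - 1}" "x \<in> {1..m*n} \<rightarrow> {0..int n - 1}"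
    "[(\<Sum>i = 1..m*n. x i) = c_const m n] (mod int n)"
  using assms by (auto simp: tuples_def PiE_def)

lemma finite_tuples [simp]: "finite (tuples m n)"
  by (rule finite_subset[of _ "{1..m*n} \<rightarrow>\<^sub>E {0..int n - 1}"]) (auto simp: tuples_def intro: finite_PiE)

lemma count_vector_in_count_vectors_iff:
  assumes "x \<in> {1..m*n} \<rightarrow>\<^sub>E {0..int n - 1}"
  shows "count_vector n {1..m*n} x \<in> count_vectors m n \<longleftrightarrow> x \<in> tuples m n"
proof -
  have x: "x \<in> {1..m*n} \<rightarrow> {0..int n - 1}"
    using assms by (simp add: PiE_def)
  show ?thesis
    using assms sum_list_count_vector[OF _ x] weight_count_vector[OF _ x]
    by (simp add: count_vectors_def tuples_def)
qed

definition functions_of_content :: "nat set \<Rightarrow> 'a multiset \<Rightarrow> (nat \<Rightarrow> 'a) set" where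
  "functions_of_content E M = {f \<in> E \<rightarrow>\<^sub>E UNIV. image_mset f (mset_set E) = M}"

lemma finite_functions_of_content [simp]:
  assumes "finite E"
  shows "finite (functions_of_content E M)"
proof (rule finite_subset)
  show "functions_of_content E M \<subseteq> E \<rightarrow>\<^sub>E set_mset M"
    using assms by (auto simp: functions_of_content_def PiE_def Pi_def)
  show "finite (E \<rightarrow>\<^sub>E set_mset M)"
    using assms by (intro finite_PiE) auto
qed

lemma comp_permutes_functions_of_content:
  assumes p: "p permutes E" and f: "f \<in> functions_of_content E M"
  shows "f \<circ> p \<in> functions_of_content E M"
proof -
  have "f \<circ> p \<in> E \<rightarrow>\<^sub>E UNIV"
    using f permutes_not_in[OF p] by (auto simp: functions_of_content_def PiE_def extensional_def)
  moreover have "image_mset (f \<circ> p) (mset_set E) = image_mset f (mset_set E)"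
  proof -
    have "image_mset p (mset_set E) = mset_set E"
      using permutes_inj[OF p] permutes_image[OF p]
      by (metis image_mset_mset_set inj_on_subset subset_UNIV)
    then show ?thesis
      by (metis multiset.map_comp)
  qed
  ultimately show ?thesis
    using f by (simp add: functions_of_content_def)
qed

lemma blocks_image:
  fixes M :: "'a multiset"
  shows "(\<lambda>(x, f). blocks n {1..m*n} x f) ` (tuples m n \<times> functions_of_content {1..m*n} M) =
    {Ms. map size Ms \<in> count_vectors m n \<and> sum_list Ms = M}"
proof (intro subset_antisym subsetI)
  fix Ms assume "Ms \<in> (\<lambda>(x, f). blocks n {1..m*n} x f) ` (tuples m n \<times> functions_of_content {1..m*n} M)"
  then obtain x f where Ms: "Ms = blocks n {1..m*n} x f"
    and x: "x \<in> tuples m n" and f: "f \<in> functions_of_content {1..m*n} M" by auto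
  have "map size Ms \<in> count_vectors m n"
    unfolding Ms map_size_blocks count_vector_in_count_vectors_iff[OF tuplesD(1)[OF x]] by (rule x)
  moreover have "sum_list Ms = M"
    unfolding Ms using sum_list_blocks[OF _ tuplesD(2)[OF x], of f] f
    by (simp add: functions_of_content_def)
  ultimately show "Ms \<in> {Ms. map size Ms \<in> count_vectors m n \<and> sum_list Ms = M}" by simp
next
  fix Ms assume "Ms \<in> {Ms. map size Ms \<in> count_vectors m n \<and> sum_list Ms = M}"
  then have Ms: "map size Ms \<in> count_vectors m n" "sum_list Ms = M" by auto
  then have "length Ms = n" "size (sum_list Ms) = m * n"
    by (auto simp: count_vectors_def sum_list_map_size[symmetric] simp del: Ms(2))
  then obtain x and f :: "nat \<Rightarrow> 'a" where x: "x \<in> {1..m*n} \<rightarrow>\<^sub>E {0..int n - 1}"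
    and f: "f \<in> {1..m*n} \<rightarrow>\<^sub>E UNIV" and eq: "blocks n {1..m*n} x f = Ms"
    by (rule ex_blocks)
  have "x \<in> tuples m n"
    unfolding count_vector_in_count_vectors_iff[OF x, symmetric] map_size_blocks[of n _ x f, symmetric] eq
    by (rule Ms(1))
  moreover have "f \<in> functions_of_content {1..m*n} M"
    using sum_list_blocks[of "{1..m*n}" x n f] x f eq Ms(2)
    by (simp add: functions_of_content_def PiE_def)
  ultimately show "Ms \<in> (\<lambda>(x, f). blocks n {1..m*n} x f) ` (tuples m n \<times> functions_of_content {1..m*n} M)"
    using eq by force
qed

lemma count_vector_image: "count_vector n {1..m*n} ` tuples m n = count_vectors m n"
proof (intro subset_antisym subsetI)
  fix b assume "b \<in> count_vector n {1..m*n} ` tuples m n"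
  then show "b \<in> count_vectors m n"
    using count_vector_in_count_vectors_iff[OF tuplesD(1)] by blast
next
  fix b assume b: "b \<in> count_vectors m n"
  define Ms where "Ms = map (\<lambda>k. replicate_mset k ()) b"
  have "map size Ms = b"
    by (simp add: Ms_def comp_def)
  then have "Ms \<in> {Ms'. map size Ms' \<in> count_vectors m n \<and> sum_list Ms' = sum_list Ms}"
    using b by simp
  then obtain x f where x: "x \<in> tuples m n" and "blocks n {1..m*n} x f = Ms"
    unfolding blocks_image[symmetric] by auto
  then have "count_vector n {1..m*n} x = b"
    using map_size_blocks[of n "{1..m*n}" x f] \<open>map size Ms = b\<close> by simp
  then show "b \<in> count_vector n {1..m*n} ` tuples m n"
    using x by blast
qed

text \<open>A pair is fixed exactly if both components are, so the products count fixed points of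
  the simultaneous action, whose orbits \<open>blocks\<close> separates.\<close>

lemma sum_fixed_tuples_times_functions:
  "(\<Sum>\<sigma> | \<sigma> permutes {1..m*n}. card {x \<in> tuples m n. x \<circ> \<sigma> = x} *
      card {f \<in> functions_of_content {1..m*n} M. f \<circ> \<sigma> = f}) =
    fact (m * n) * card {Ms. map size Ms \<in> count_vectors m n \<and> sum_list Ms = M}"
proof -
  let ?E = "{1..m*n}"
  let ?T = "tuples m n \<times> functions_of_content ?E M"
  have "{t \<in> ?T. (case t of (x, f) \<Rightarrow> (x \<circ> \<sigma>, f \<circ> \<sigma>)) = t} =
      {x \<in> tuples m n. x \<circ> \<sigma> = x} \<times> {f \<in> functions_of_content ?E M. f \<circ> \<sigma> = f}" for \<sigma>
    by auto
  then have "(\<Sum>\<sigma> | \<sigma> permutes ?E. card {x \<in> tuples m n. x \<circ> \<sigma> = x} *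
        card {f \<in> functions_of_content ?E M. f \<circ> \<sigma> = f}) =
      (\<Sum>\<sigma> | \<sigma> permutes ?E. card {t \<in> ?T. (case t of (x, f) \<Rightarrow> (x \<circ> \<sigma>, f \<circ> \<sigma>)) = t})"
    by (simp add: card_cartesian_product)
  also have "\<dots> = fact (card ?E) * card ((\<lambda>(x, f). blocks n ?E x f) ` ?T)"
  proof (rule sum_card_fixed_points)
    fix t u assume "t \<in> ?T" "u \<in> ?T"
    then obtain x f y g where t: "t = (x, f)" and u: "u = (y, g)"
      and "x \<in> tuples m n" "y \<in> tuples m n"
      and "f \<in> functions_of_content ?E M" "g \<in> functions_of_content ?E M" by blast
    then show "(case t of (x, f) \<Rightarrow> blocks n ?E x f) = (case u of (x, f) \<Rightarrow> blocks n ?E x f) \<longleftrightarrow>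
        (\<exists>p. p permutes ?E \<and> (case t of (x, f) \<Rightarrow> (x \<circ> p, f \<circ> p)) = u)"
      unfolding t u using blocks_eq_iff[of ?E x n y f g] tuplesD(1)[of _ m n]
      by (simp add: functions_of_content_def)
  qed (auto simp: perm_tuples comp_permutes_functions_of_content comp_assoc)
  finally show ?thesis
    unfolding blocks_image by simp
qed

lemma sum_fixed_tuples:
  "(\<Sum>\<sigma> | \<sigma> permutes {1..m*n}. card {x \<in> tuples m n. x \<circ> \<sigma> = x}) =
    fact (m * n) * card (count_vectors m n)"
proof -
  have "(\<Sum>\<sigma> | \<sigma> permutes {1..m*n}. card {x \<in> tuples m n. x \<circ> \<sigma> = x}) =
      fact (card {1..m*n}) * card (count_vector n {1..m*n} ` tuples m n)"
  proof (rule sum_card_fixed_points[where act = "\<lambda>p x. x \<circ> p"])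
    fix x y assume "x \<in> tuples m n" "y \<in> tuples m n"
    then show "count_vector n {1..m*n} x = count_vector n {1..m*n} y \<longleftrightarrow>
        (\<exists>p. p permutes {1..m*n} \<and> x \<circ> p = y)"
      by (intro count_vector_eq_iff tuplesD(1)) auto
  qed (auto simp: perm_tuples comp_assoc)
  then show ?thesis
    unfolding count_vector_image by simp
qed

section \<open>Shifts and shift classes\<close>

lemma count_vector_shift:
  assumes x: "x \<in> tuples m n"
  shows "count_vector n {1..m*n} (shift m n x) = rotate1 (count_vector n {1..m*n} x)"
proof (rule nth_equalityI)
  fix i assume "i < length (count_vector n {1..m*n} (shift m n x))"
  then have i: "i < n" by simp
  \<comment> \<open>Residue n-1-i is reached from residue n-1-(i+1), and residue 0 from n-1. Listing
    the residues in descending order is what makes the shift a rotation to the left.\<close>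
  have "(a + 1) mod int n = int n - 1 - int i \<longleftrightarrow> a = int n - 1 - int (Suc i mod n)"
    if "0 \<le> a" "a < int n" for a
  proof (cases "a + 1 = int n")
    case True
    then show ?thesis
      using i by (cases "Suc i = n") auto
  next
    case False
    then show ?thesis
      using i that by (cases "Suc i = n") auto
  qed
  moreover have "0 \<le> x j \<and> x j < int n" if "j \<in> {1..m*n}" for j
    using tuplesD(2)[OF x] that by (auto simp: Pi_def)
  ultimately have "{j\<in>{1..m*n}. shift m n x j = int n - 1 - int i} =
      {j\<in>{1..m*n}. x j = int n - 1 - int (Suc i mod n)}"
    by (auto simp: shift_def)
  then show "count_vector n {1..m*n} (shift m n x) ! i = rotate1 (count_vector n {1..m*n} x) ! i"
    using i by (simp add: nth_rotate1 nth_count_vector)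
qed simp

lemma count_vector_funpow_shift:
  assumes "n > 0" "x \<in> tuples m n"
  shows "count_vector n {1..m*n} ((shift m n ^^ j) x) = rotate j (count_vector n {1..m*n} x)"
proof (induction j)
  case (Suc j)
  then show ?case
    using count_vector_shift[OF funpow_shift_tuples[OF assms, of j]] by simp
qed simp

lemma shift_class_eq:
  assumes n: "n > 0" and x: "x \<in> tuples m n"
  shows "shift_rel m n `` {x} = (\<lambda>j. (shift m n ^^ j) x) ` {..<n}"
proof -
  have "(shift m n ^^ j) x = (shift m n ^^ (j mod n)) x" for j
    unfolding funpow_shift_eq[OF x] by (auto simp: of_nat_mod mod_simps cong: restrict_cong)
  then have "(shift m n ^^ j) x \<in> (\<lambda>j. (shift m n ^^ j) x) ` {..<n}" for j
    using n by (metis imageI lessThan_iff mod_less_divisor)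
  then show ?thesis
    using x by (auto simp: shift_rel_def)
qed

text \<open>Permuting keeps the multiplicities while j shifts rotate them by j, so aperiodicity of
  the multiplicity vector forces j = 0.\<close>

lemma funpow_shift_eq_comp_iff:
  assumes n: "n > 0" and x: "x \<in> tuples m n" and p: "p permutes {1..m*n}" and j: "j < n"
    and eq: "(shift m n ^^ j) x = x \<circ> p"
  shows "j = 0"
proof -
  let ?b = "count_vector n {1..m*n} x"
  have b: "?b \<in> count_vectors m n"
    using count_vector_image x by blast
  have "count_vector n {1..m*n} (x \<circ> p) = ?b"
    using count_vector_eq_iff[of "{1..m*n}" x n "x \<circ> p"] p tuplesD(1)[OF x]
      tuplesD(1)[OF perm_tuples[OF p x]] by auto
  then have "rotate j ?b = rotate 0 ?b"
    using count_vector_funpow_shift[OF n x, of j] eq by simp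
  then show ?thesis
    using inj_onD[OF inj_on_rotate_count_vectors[OF b], of j 0] j n by simp
qed

lemma card_shift_class:
  assumes n: "n > 0" and x: "x \<in> tuples m n"
  shows "card (shift_rel m n `` {x}) = n"
proof -
  have "inj_on (\<lambda>j. (shift m n ^^ j) x) {..<n}"
  proof (rule inj_onI)
    fix j k assume *: "j \<in> {..<n}" "k \<in> {..<n}" "(shift m n ^^ j) x = (shift m n ^^ k) x"
    have b: "count_vector n {1..m*n} x \<in> count_vectors m n"
      using count_vector_image x by blast
    show "j = k"
      using inj_onD[OF inj_on_rotate_count_vectors[OF b] _ *(1,2)] *(3)
        count_vector_funpow_shift[OF n x] by metis
  qed
  then show ?thesis
    unfolding shift_class_eq[OF n x] by (simp add: card_image)
qed

text \<open>The shift moves every tuple out of its \<open>S\<^sub>N\<close>-orbit, so a fixed class consists of fixed tuples.\<close>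

lemma class_fixed_iff:
  assumes n: "n > 0" and \<sigma>: "\<sigma> permutes {1..m*n}" and K: "K \<in> tuple_classes m n" and x: "x \<in> K"
  shows "class_action m n \<sigma> K = K \<longleftrightarrow> x \<circ> \<sigma> = x"
proof -
  have xt: "x \<in> tuples m n"
    using K x in_quotient_imp_subset[OF equiv_shift_rel[OF n]] unfolding tuple_classes_def by blast
  have Kx: "K = shift_rel m n `` {x}"
  proof -
    obtain a where "K = shift_rel m n `` {a}"
      using K unfolding tuple_classes_def by (rule quotientE)
    then show ?thesis
      using x equiv_class_eq[OF equiv_shift_rel[OF n], of a x] by simp
  qed
  have \<sigma>': "inv' \<sigma> permutes {1..m*n}"
    using \<sigma> by (rule permutes_inv)
  have act: "class_action m n \<sigma> K = shift_rel m n `` {x \<circ> inv' \<sigma>}"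
  proof -
    have "class_action m n \<sigma> K = (\<lambda>y. y \<circ> inv' \<sigma>) ` K"
      using K by (simp add: class_action_def)
    also have "\<dots> = shift_rel m n `` {x \<circ> inv' \<sigma>}"
      unfolding Kx by (rule perm_class[OF \<sigma>' xt])
    finally show ?thesis .
  qed
  have "class_action m n \<sigma> K = K \<longleftrightarrow> x \<circ> inv' \<sigma> = x"
  proof
    assume "class_action m n \<sigma> K = K"
    then have "x \<circ> inv' \<sigma> \<in> shift_rel m n `` {x}"
      using act Kx equiv_class_self[OF equiv_shift_rel[OF n] perm_tuples[OF \<sigma>' xt]] by simp
    then obtain j where "j < n" "x \<circ> inv' \<sigma> = (shift m n ^^ j) x"
      unfolding shift_class_eq[OF n xt] by auto
    then show "x \<circ> inv' \<sigma> = x"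
      using funpow_shift_eq_comp_iff[OF n xt \<sigma>', of j] by auto
  qed (use act Kx in simp)
  also have "\<dots> \<longleftrightarrow> x \<circ> \<sigma> = x"
  proof
    assume *: "x \<circ> inv' \<sigma> = x"
    have "(x \<circ> inv' \<sigma>) \<circ> \<sigma> = x"
      unfolding comp_assoc permutes_inv_o(2)[OF \<sigma>] by simp
    then show "x \<circ> \<sigma> = x"
      unfolding * .
  next
    assume *: "x \<circ> \<sigma> = x"
    have "(x \<circ> \<sigma>) \<circ> inv' \<sigma> = x"
      unfolding comp_assoc permutes_inv_o(1)[OF \<sigma>] by simp
    then show "x \<circ> inv' \<sigma> = x"
      unfolding * .
  qed
  finally show ?thesis .
qed

lemma finite_tuple_classes:
  assumes "n > 0"
  shows "finite (tuple_classes m n)"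
  unfolding tuple_classes_def
  by (rule finite_quotient) (auto simp: shift_rel_def funpow_shift_tuples[OF assms])

text \<open>Each fixed class consists of n fixed tuples, and the class of a fixed tuple is fixed, so
  the fixed classes partition the fixed tuples.\<close>

lemma card_fixed_classes:
  assumes n: "n > 0" and \<sigma>: "\<sigma> permutes {1..m*n}"
  shows "n * card {K \<in> tuple_classes m n. class_action m n \<sigma> K = K} =
    card {x \<in> tuples m n. x \<circ> \<sigma> = x}"
proof -
  let ?F = "{K \<in> tuple_classes m n. class_action m n \<sigma> K = K}"
  have un: "\<Union>?F = {x \<in> tuples m n. x \<circ> \<sigma> = x}"
  proof (intro subset_antisym subsetI)
    fix x assume "x \<in> \<Union>?F"
    then obtain K where "x \<in> K" "K \<in> tuple_classes m n" "class_action m n \<sigma> K = K" by blast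
    then show "x \<in> {x \<in> tuples m n. x \<circ> \<sigma> = x}"
      using class_fixed_iff[OF n \<sigma>] in_quotient_imp_subset[OF equiv_shift_rel[OF n]]
      unfolding tuple_classes_def by blast
  next
    fix x assume x: "x \<in> {x \<in> tuples m n. x \<circ> \<sigma> = x}"
    then have "shift_rel m n `` {x} \<in> tuple_classes m n" "x \<in> shift_rel m n `` {x}"
      using equiv_class_self[OF equiv_shift_rel[OF n]] by (auto simp: tuple_classes_def intro: quotientI)
    then show "x \<in> \<Union>?F"
      using class_fixed_iff[OF n \<sigma>] x by blast
  qed
  have "finite ?F"
    using finite_tuple_classes[OF n] by simp
  moreover have "card K = n" if "K \<in> ?F" for K
    using that card_shift_class[OF n] by (auto simp: tuple_classes_def elim!: quotientE)
  moreover have "K \<inter> L = {}" if "K \<in> ?F" "L \<in> ?F" "K \<noteq> L" for K L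
    using that quotient_disj[OF equiv_shift_rel[OF n]] by (auto simp: tuple_classes_def)
  moreover have "finite (\<Union>?F)"
    unfolding un by simp
  ultimately have "n * card ?F = card (\<Union>?F)"
    by (intro card_partition) auto
  then show ?thesis
    unfolding un .
qed

section \<open>Nonincreasing tuples\<close>

lemma card_noninc_tuples: "card (noninc_tuples m n) = card (count_vectors m n)"
proof -
  let ?E = "{1..m*n}"
  \<comment> \<open>The tuple is read backwards, so that nonincreasing tuples become ascending
    lists, which sorting determines from their content.\<close>
  define L where "L x = map (\<lambda>i. x (m * n - i)) [0..<m*n]" for x :: "nat \<Rightarrow> int"
  have msetL: "mset (L x) = image_mset x (mset_set ?E)" for x
  proof -
    have "(\<lambda>i. m * n - i) ` {0..<m*n} = ?E"
    proof (intro subset_antisym subsetI)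
      fix j assume "j \<in> ?E"
      then show "j \<in> (\<lambda>i. m * n - i) ` {0..<m*n}"
        by (intro image_eqI[of _ _ "m * n - j"]) auto
    qed auto
    then have "mset_set ?E = image_mset (\<lambda>i. m * n - i) (mset_set {0..<m*n})"
      by (subst image_mset_mset_set) (auto simp: inj_on_def)
    then show ?thesis
      by (simp add: L_def image_mset.compositionality comp_def)
  qed
  have L_nth: "L x ! (m * n - j) = x j" if "j \<in> ?E" for x j
    using that by (auto simp: L_def)
  have sorted: "L x = sorted_list_of_multiset (image_mset x (mset_set ?E))"
    if "x \<in> noninc_tuples m n" for x
  proof -
    have "x (m * n - i) \<le> x (m * n - j)" if "i \<le> j" "j < m * n" for i j
      using \<open>x \<in> noninc_tuples m n\<close> that
      by (intro monotone_onD[of ?E "(\<le>)" "(\<ge>)" x]) (auto simp: noninc_tuples_def)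
    then have "sorted (L x)"
      by (auto simp: L_def sorted_iff_nth_mono)
    then show ?thesis
      by (metis msetL sorted_list_of_multiset_mset sorted_sort_id)
  qed
  have perm: "image_mset x (mset_set ?E) = image_mset y (mset_set ?E) \<longleftrightarrow>
      count_vector n ?E x = count_vector n ?E y" if x: "x \<in> tuples m n" and y: "y \<in> tuples m n" for x y
  proof -
    have "image_mset x (mset_set ?E) = image_mset y (mset_set ?E) \<longleftrightarrow> (\<exists>p. p permutes ?E \<and> x \<circ> p = y)"
    proof
      assume "image_mset x (mset_set ?E) = image_mset y (mset_set ?E)"
      then obtain p where p: "p permutes ?E" "\<forall>j\<in>?E. y j = x (p j)"
        using image_mset_eq_implies_permutes[of ?E y x] by auto
      have "(x \<circ> p) j = y j" for j
        using p PiE_arb[OF tuplesD(1)[OF x], of j] PiE_arb[OF tuplesD(1)[OF y], of j]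
          permutes_not_in[OF p(1), of j] by (cases "j \<in> ?E") auto
      then show "\<exists>p. p permutes ?E \<and> x \<circ> p = y"
        using p(1) by blast
    next
      assume "\<exists>p. p permutes ?E \<and> x \<circ> p = y"
      then obtain p where p: "p permutes ?E" "x \<circ> p = y" by blast
      have "x \<in> functions_of_content ?E (image_mset x (mset_set ?E))"
        using tuplesD(1)[OF x] by (simp add: functions_of_content_def PiE_def)
      from comp_permutes_functions_of_content[OF p(1) this]
      show "image_mset x (mset_set ?E) = image_mset y (mset_set ?E)"
        by (simp add: functions_of_content_def p(2))
    qed
    then show ?thesis
      using count_vector_eq_iff[OF _ tuplesD(1)[OF x] tuplesD(1)[OF y]] by simp
  qed
  have "bij_betw (count_vector n ?E) (noninc_tuples m n) (count_vectors m n)"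
  proof (rule bij_betw_imageI)
    show "inj_on (count_vector n ?E) (noninc_tuples m n)"
    proof (rule inj_onI)
      fix x y assume *: "x \<in> noninc_tuples m n" "y \<in> noninc_tuples m n"
        "count_vector n ?E x = count_vector n ?E y"
      then have xy: "x \<in> tuples m n" "y \<in> tuples m n"
        by (auto simp: noninc_tuples_def)
      then have "L x = L y"
        using sorted * perm by metis
      then have "x j = y j" if "j \<in> ?E" for j
        using L_nth[OF that] by metis
      then show "x = y"
        using tuplesD(1)[OF xy(1)] tuplesD(1)[OF xy(2)] by (auto intro: PiE_ext)
    qed
    show "count_vector n ?E ` noninc_tuples m n = count_vectors m n"
    proof (intro subset_antisym subsetI)
      fix b assume "b \<in> count_vectors m n"
      then obtain x where x: "x \<in> tuples m n" "b = count_vector n ?E x"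
        using count_vector_image by blast
      \<comment> \<open>Sorting the reversed tuple and reading it backwards gives the nonincreasing
        tuple of the same orbit.\<close>
      define l where "l = sort (L x)"
      have len: "length l = m * n"
        by (simp add: l_def L_def)
      define y where "y = (\<lambda>j\<in>?E. l ! (m * n - j))"
      have Ly: "L y = l"
        by (rule nth_equalityI) (auto simp: L_def y_def len)
      have content: "image_mset y (mset_set ?E) = image_mset x (mset_set ?E)"
        unfolding msetL[symmetric] Ly by (simp add: l_def)
      have img: "y ` ?E = x ` ?E"
        using arg_cong[OF content, of set_mset] by simp
      have "y \<in> ?E \<rightarrow>\<^sub>E {0..int n - 1}"
      proof (rule PiE_I)
        fix j assume "j \<in> ?E"
        then have "y j \<in> x ` ?E"
          unfolding img[symmetric] by (rule imageI)
        then show "y j \<in> {0..int n - 1}"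
        proof
          fix i assume "y j = x i" "i \<in> ?E"
          then show ?thesis
            using funcset_mem[OF tuplesD(2)[OF x(1)], of i] by simp
        qed
      qed (auto simp: y_def)
      moreover have "(\<Sum>i\<in>?E. y i) = (\<Sum>i\<in>?E. x i)"
        using content by (metis sum_unfold_sum_mset)
      ultimately have yt: "y \<in> tuples m n"
        using tuplesD(3)[OF x(1)] by (simp add: tuples_def)
      have "antimono_on ?E y"
      proof (rule monotone_onI)
        fix i j assume "i \<in> ?E" "j \<in> ?E" "i \<le> j"
        then show "y j \<le> y i"
          using sorted_nth_mono[of l "m * n - j" "m * n - i"] len
          by (simp add: y_def l_def)
      qed
      then have "y \<in> noninc_tuples m n"
        using yt by (simp add: noninc_tuples_def)
      moreover have "count_vector n ?E y = b"
        using perm[OF yt x(1)] content x(2) by simp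
      ultimately show "b \<in> count_vector n ?E ` noninc_tuples m n"
        by blast
    qed (use count_vector_image in \<open>auto simp: noninc_tuples_def\<close>)
  qed
  then show ?thesis
    by (rule bij_betw_same_card)
qed

section \<open>Frobenius characteristic and number of orbits\<close>

lemma Frob_tau_hat:
  assumes n: "n > 0"
  shows "of_nat n * Frob (m * n) (tuple_classes m n) (tau_hat m n) M =
    (\<Sum>b\<in>count_vectors m n. h_sym b M)"
proof -
  let ?fix = "\<lambda>\<sigma>. card {x \<in> tuples m n. x \<circ> \<sigma> = x}"
  let ?fun = "\<lambda>\<sigma>. card {f \<in> functions_of_content {1..m*n} M. f \<circ> \<sigma> = f}"
  have fin: "finite (tuple_classes m n)"
    using finite_tuple_classes[OF n] .
  \<comment> \<open>The factor n turns fixed classes into fixed tuples, and the power sum counts the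
    fixed functions.\<close>
  have summand: "of_nat n * (rep_character (tuple_classes m n) (tau_hat m n) \<sigma> *
      p_sym (cycle_type (m * n) \<sigma>) M) = of_nat (?fix \<sigma> * ?fun \<sigma>)" if \<sigma>: "\<sigma> permutes {1..m*n}" for \<sigma>
  proof -
    have "rep_character (tuple_classes m n) (tau_hat m n) \<sigma> =
        (\<Sum>K\<in>tuple_classes m n. if class_action m n \<sigma> K = K then 1 else 0)"
      unfolding rep_character_def tau_hat_def perm_rep_def by (rule sum.cong) auto
    also have "\<dots> = of_nat (card {K \<in> tuple_classes m n. class_action m n \<sigma> K = K})"
      using fin by (simp add: sum.If_cases Int_def)
    finally have "of_nat n * rep_character (tuple_classes m n) (tau_hat m n) \<sigma> = of_nat (?fix \<sigma>)"
      unfolding card_fixed_classes[OF n \<sigma>, symmetric] by simp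
    moreover have "p_sym (cycle_type (m * n) \<sigma>) M = of_nat (?fun \<sigma>)"
    proof -
      have "{f \<in> {1..m*n} \<rightarrow>\<^sub>E UNIV. f \<circ> \<sigma> = f \<and> image_mset f (mset_set {1..m*n}) = M} =
          {f \<in> functions_of_content {1..m*n} M. f \<circ> \<sigma> = f}"
        unfolding functions_of_content_def by blast
      then show ?thesis
        unfolding p_sym_cycle_type[OF \<sigma>] by (rule arg_cong)
    qed
    ultimately show ?thesis
      by (simp only: of_nat_mult mult.assoc[symmetric])
  qed
  have "of_nat n * Frob (m * n) (tuple_classes m n) (tau_hat m n) M =
      (\<Sum>\<sigma> | \<sigma> permutes {1..m*n}. of_nat n * (rep_character (tuple_classes m n) (tau_hat m n) \<sigma> *
        p_sym (cycle_type (m * n) \<sigma>) M)) / fact (m * n)"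
    by (simp add: Frob_def sym_group_def sum_distrib_left)
  also have "\<dots> = of_nat (\<Sum>\<sigma> | \<sigma> permutes {1..m*n}. ?fix \<sigma> * ?fun \<sigma>) / fact (m * n)"
    by (simp add: summand)
  also have "\<dots> = of_nat (card {Ms. map size Ms \<in> count_vectors m n \<and> sum_list Ms = M})"
    unfolding sum_fixed_tuples_times_functions by simp
  \<comment> \<open>Splitting the lists of multisets by their size vectors produces the coefficients
    of \<open>h_sym b\<close>.\<close>
  also have "{Ms. map size Ms \<in> count_vectors m n \<and> sum_list Ms = M} =
      (\<Union>b\<in>count_vectors m n. {Ms. map size Ms = b \<and> sum_list Ms = M})"
    by auto
  also have "card \<dots> = (\<Sum>b\<in>count_vectors m n. card {Ms. map size Ms = b \<and> sum_list Ms = M})"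
    by (rule card_UN_disjoint) auto
  finally show ?thesis
    by (simp add: h_sym_eq_card)
qed

lemma card_orbits_tuple_classes:
  assumes n: "n > 0"
  shows "n * card (orbits (sym_group (m * n)) (tuple_classes m n) (class_action m n)) =
    card (count_vectors m n)"
proof -
  interpret group_action "sym_group (m * n)" "tuple_classes m n" "class_action m n"
    by (rule group_action_class_action)
  let ?o = "card (orbits (sym_group (m * n)) (tuple_classes m n) (class_action m n))"
  have P: "carrier (sym_group (m * n)) = {\<sigma>. \<sigma> permutes {1..m*n}}"
    by (simp add: sym_group_def)
  \<comment> \<open>This is Burnside's lemma for the classes. Multiplied by n, the fixed classes
    become fixed tuples, whose total is \<open>sum_fixed_tuples\<close>.\<close>
  have "?o * Coset.order (sym_group (m * n)) = (\<Sum>\<sigma>\<in>carrier (sym_group (m * n)).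
      card (invariants (tuple_classes m n) (class_action m n) \<sigma>))"
    by (rule burnside) (simp_all add: P finite_permutations finite_tuple_classes[OF n])
  then have "n * (?o * fact (m * n)) = (\<Sum>\<sigma> | \<sigma> permutes {1..m*n}.
      n * card {K \<in> tuple_classes m n. class_action m n \<sigma> K = K})"
    by (simp add: Coset.order_def P card_permutations invariants_def sum_distrib_left)
  also have "\<dots> = (\<Sum>\<sigma> | \<sigma> permutes {1..m*n}. card {x \<in> tuples m n. x \<circ> \<sigma> = x})"
    by (rule sum.cong) (simp_all add: card_fixed_classes[OF n])
  also have "\<dots> = fact (m * n) * card (count_vectors m n)"
    by (rule sum_fixed_tuples)
  finally show ?thesis
    by simp
qed

theorem theorem3p3:
  fixes m n :: nat
  assumes "m > 0" and "n > 0"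
  shows
    "Frob (m * n) (tuple_classes m n) (tau_hat m n) =
       (\<lambda>M. \<Sum>w\<in>BL_words m n. h_sym (sort_noninc (one_runs w)) M) \<and>
     card (orbits (sym_group (m * n)) (tuple_classes m n) (class_action m n)) =
       card (BL_words m n) \<and>
     real (card (BL_words m n)) = real (card (noninc_tuples m n)) / real n \<and>
     real (card (noninc_tuples m n)) / real n =
       1 / (real n)\<^sup>2 * (\<Sum>d | d dvd n. (-1) ^ (m * (n + d)) *
         real_of_int (moebius_mu (n div d)) * real (((m + 1) * d - 1) choose (m * d)))"
proof (intro conjI)
  \<comment> \<open>With the constant summand 1, every Lyndon word is counted once for each of the n
    rotations of its vector.\<close>
  have card_BL: "card (count_vectors m n) = n * card (BL_words m n)"
    using sum_count_vectors_eq_sum_BL_words[of n m "\<lambda>_. 1 :: nat"] assms(2) by simp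
  show "Frob (m * n) (tuple_classes m n) (tau_hat m n) =
      (\<lambda>M. \<Sum>w\<in>BL_words m n. h_sym (sort_noninc (one_runs w)) M)"
  proof
    fix M
    let ?H = "\<lambda>w. h_sym (sort_noninc (one_runs w)) M"
    have "of_nat n * Frob (m * n) (tuple_classes m n) (tau_hat m n) M =
        (\<Sum>b\<in>count_vectors m n. ?H (gap_word b))"
      by (simp only: Frob_tau_hat[OF assms(2)] h_sym_one_runs)
    also have "\<dots> = of_nat n * (\<Sum>w\<in>BL_words m n. ?H w)"
    proof (rule sum_count_vectors_eq_sum_BL_words[OF assms(2)])
      fix b k
      have "h_sym (rotate k b) = h_sym b"
        by (rule h_sym_mset_cong) simp
      then show "?H (gap_word (rotate k b)) = ?H (gap_word b)"
        by (simp only: h_sym_one_runs)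
    qed
    finally show "Frob (m * n) (tuple_classes m n) (tau_hat m n) M = (\<Sum>w\<in>BL_words m n. ?H w)"
      using assms(2) by simp
  qed
  show "card (orbits (sym_group (m * n)) (tuple_classes m n) (class_action m n)) =
      card (BL_words m n)"
    using card_orbits_tuple_classes[OF assms(2), of m] card_BL assms(2) by simp
  show "real (card (BL_words m n)) = real (card (noninc_tuples m n)) / real n"
    using assms(2) by (simp add: card_noninc_tuples card_BL)
  show "real (card (noninc_tuples m n)) / real n =
      1 / (real n)\<^sup>2 * (\<Sum>d | d dvd n. (-1) ^ (m * (n + d)) *
        real_of_int (moebius_mu (n div d)) * real (((m + 1) * d - 1) choose (m * d)))"
    unfolding card_count_vectors[OF assms(2), symmetric] card_noninc_tuples
    using assms(2) by (simp add: power2_eq_square)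
qed

end
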